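(* Let $k$ be a field of characteristic zero and $R=k[x_1,x_2,x_3,x_4]$. Let $\mathcal Q$ be a smooth quadric surface in $\mathbb P^3$ defined by $Q\in R_2$, and let $t$ be a positive integer. Then $$(Q^t)^{\perp}=(\ell^{t+1}\ |\ \ell^{\vee}\in\mathcal Q),$$ and $R/(Q^t)^{\perp}$ is a compressed Gorenstein algebra.
   Context: $R$ has the standard grading. For forms $F,G\in R$, $\frac{\partial F}{\partial G}$ denotes the result of applying to $F$ the constant-coefficient differential operator $G(\partial/\partial x_1,\dots,\partial/\partial x_4)$. For a form $F$, $F^{\perp}$ is the ideal of $R$ generated by the forms $G$ with $\frac{\partial F}{\partial G}=0$; $R/F^\perp$ is an artinian Gorenstein algebra with socle degree $\deg F$. For a nonzero linear form $\ell=\sum\alpha_i x_i$, the dual point is $\ell^{\vee}=[\alpha_1:\dots:\alpha_4]\in\mathbb P^3$. The right-hand ideal is generated by all $\ell^{t+1}$ where $\ell$ runs over the nonzero linear forms with $\ell^\vee\in\mathcal Q$. An artinian graded Gorenstein quotient $A$ of $R$ with socle degree $j$ is compressed if its Hilbert function is the maximal possible one: $\dim_k [A]_i=\min\{\dim_k [R]_i,\dim_k [R]_{j-i}\}$ for $0\le i\le j$.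
   Formalization: The ideal equality over k is stated only when the quadric has a k-point (it fails for x1²+x2²+x3²+x4² over the reals, where no ℓ exists); for every k it is stated after extending scalars to the algebraic closure. *)

theory Defs
  imports
    "HOL-Library.Poly_Mapping"
    "HOL-Library.Numeral_Type"
    "HOL-Algebra.Algebraic_Closure_Type"
begin

(* Exponent vectors are finitely supported maps from the four-element type 4 to nat, so the
   convolution product of Poly_Mapping makes 'k poly4 the polynomial ring k[x_1,...,x_4].
   In the type 4 the numerals 1, 2, 3, 4 denote the four distinct elements (4 = 0). *)
type_synonym expo4 = "4 \<Rightarrow>\<^sub>0 nat"
type_synonym 'k poly4 = "expo4 \<Rightarrow>\<^sub>0 'k"

definition expo_degree :: "expo4 \<Rightarrow> nat" where
  "expo_degree m = (\<Sum>i\<in>UNIV. Poly_Mapping.lookup m i)"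

definition var :: "4 \<Rightarrow> 'k::comm_ring_1 poly4" where
  "var i = Poly_Mapping.single (Poly_Mapping.single i 1) 1"

definition smul :: "'k::comm_ring_1 \<Rightarrow> 'k poly4 \<Rightarrow> 'k poly4" where
  "smul c F = Poly_Mapping.single 0 c * F"

(* The graded piece [R]_d; it contains 0. *)
definition forms :: "nat \<Rightarrow> 'k::comm_ring_1 poly4 set" where
  "forms d = {F. \<forall>m\<in>Poly_Mapping.keys F. expo_degree m = d}"

definition eval4 :: "(4 \<Rightarrow> 'k) \<Rightarrow> 'k::comm_ring_1 poly4 \<Rightarrow> 'k" where
  "eval4 a F =
     (\<Sum>m\<in>Poly_Mapping.keys F. Poly_Mapping.lookup F m * (\<Prod>i\<in>UNIV. a i ^ Poly_Mapping.lookup m i))"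

definition base_change :: "'k::field poly4 \<Rightarrow> 'k alg_closure poly4" where
  "base_change = Poly_Mapping.map to_ac"

(* A summand whose exponent at i is 0 has coefficient 0, so the truncated subtraction on
   exponents is harmless. *)
definition partial :: "4 \<Rightarrow> 'k::comm_ring_1 poly4 \<Rightarrow> 'k poly4" where
  "partial i F =
     (\<Sum>m\<in>Poly_Mapping.keys F.
        Poly_Mapping.single (m - Poly_Mapping.single i 1)
          (of_nat (Poly_Mapping.lookup m i) * Poly_Mapping.lookup F m))"

definition partial_expo :: "expo4 \<Rightarrow> 'k::comm_ring_1 poly4 \<Rightarrow> 'k poly4" where
  "partial_expo m F =
     (partial 1 ^^ Poly_Mapping.lookup m 1) ((partial 2 ^^ Poly_Mapping.lookup m 2)
       ((partial 3 ^^ Poly_Mapping.lookup m 3) ((partial 4 ^^ Poly_Mapping.lookup m 4) F)))"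

(* diff_by F G is the result of applying the operator G(d/dx_1,...,d/dx_4) to F. *)
definition diff_by :: "'k::comm_ring_1 poly4 \<Rightarrow> 'k poly4 \<Rightarrow> 'k poly4" where
  "diff_by F G = (\<Sum>m\<in>Poly_Mapping.keys G.
     smul (Poly_Mapping.lookup G m) (partial_expo m F))"

(* Ideals are the submodules of the ring regarded as a module over itself. *)
definition is_ideal :: "'a::comm_ring_1 set \<Rightarrow> bool" where
  "is_ideal = Modules.module.subspace (*)"

definition ideal_gen :: "'a::comm_ring_1 set \<Rightarrow> 'a set" where
  "ideal_gen = Modules.module.span (*)"

lemma module_mult: "Modules.module ((*) :: 'a::comm_ring_1 \<Rightarrow> 'a \<Rightarrow> 'a)"
  by unfold_locales (simp_all add: algebra_simps)

lemma vector_space_smul: "vector_space (smul :: 'k::field \<Rightarrow> 'k poly4 \<Rightarrow> 'k poly4)"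
proof
  show "smul 1 x = x" for x :: "'k poly4"
    by (simp add: smul_def)
qed (simp_all add: smul_def algebra_simps single_add mult_single flip: mult.assoc)

definition perp :: "'k::comm_ring_1 poly4 \<Rightarrow> 'k poly4 set" where
  "perp F = ideal_gen {G. (\<exists>d. G \<in> forms d) \<and> diff_by F G = 0}"

(* Points of projective 3-space are represented by nonzero coordinate vectors; vanishing of a
   form does not depend on the representative. proj_zeros F consists of the points with
   coordinates in 'k itself, and can be empty if 'k is not algebraically closed. *)
definition proj_zeros :: "'k::comm_ring_1 poly4 \<Rightarrow> (4 \<Rightarrow> 'k) set" where
  "proj_zeros F = {a. a \<noteq> (\<lambda>_. 0) \<and> eval4 a F = 0}"

definition dual_point :: "'k::comm_ring_1 poly4 \<Rightarrow> 4 \<Rightarrow> 'k" where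
  "dual_point l = (\<lambda>i. Poly_Mapping.lookup l (Poly_Mapping.single i 1))"

(* Jacobian criterion at all geometric points. Q = 0 is excluded, as every point would then
   be singular. *)
definition smooth_quadric :: "'k::field poly4 \<Rightarrow> bool" where
  "smooth_quadric Q \<longleftrightarrow> Q \<in> forms 2 \<and>
     (\<forall>a\<in>proj_zeros (base_change Q). \<exists>i. eval4 a (partial i (base_change Q)) \<noteq> 0)"

(* The ideal generated by all l^n with l a nonzero linear form whose dual point lies on the
   zero set of Q. *)
definition dual_power_ideal :: "'k::comm_ring_1 poly4 \<Rightarrow> nat \<Rightarrow> 'k poly4 set" where
  "dual_power_ideal Q n =
     ideal_gen {l ^ n | l. l \<in> forms 1 \<and> l \<noteq> 0 \<and> dual_point l \<in> proj_zeros Q}"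

definition homogeneous_ideal :: "'k::comm_ring_1 poly4 set \<Rightarrow> bool" where
  "homogeneous_ideal I \<longleftrightarrow> ideal_gen {F \<in> I. \<exists>d. F \<in> forms d} = I"

(* Descending chain condition for R/I, whose ideals correspond to the ideals of R above I. *)
definition artinian_quotient :: "'k::comm_ring_1 poly4 set \<Rightarrow> bool" where
  "artinian_quotient I \<longleftrightarrow>
     \<not> (\<exists>J :: nat \<Rightarrow> 'k poly4 set. \<forall>n. is_ideal (J n) \<and> I \<subseteq> J n \<and> J (Suc n) \<subset> J n)"

(* For an artinian graded quotient A = R/I, being Gorenstein with socle degree j means that
   the socle (0 : (x_1,...,x_4)) of A is one-dimensional and lies in [A]_j: it is the line
   spanned by the nonzero class of a form s of degree j. *)
definition gorenstein_quotient :: "'k::field poly4 set \<Rightarrow> nat \<Rightarrow> bool" where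
  "gorenstein_quotient I j \<longleftrightarrow> homogeneous_ideal I \<and> artinian_quotient I \<and>
     (\<exists>s\<in>forms j. s \<notin> I \<and> (\<forall>F. (\<forall>i. var i * F \<in> I) \<longleftrightarrow> (\<exists>c. F - smul c s \<in> I)))"

abbreviation dim_k :: "'k::field poly4 set \<Rightarrow> nat" where
  "dim_k \<equiv> vector_space.dim smul"

(* dim_k [R/I]_i, where [R/I]_i = [R]_i / [I]_i. *)
definition hilbert_fun :: "'k::field poly4 set \<Rightarrow> nat \<Rightarrow> nat" where
  "hilbert_fun I i = dim_k (forms i :: 'k poly4 set) - dim_k (I \<inter> forms i)"

definition compressed_gorenstein :: "'k::field poly4 set \<Rightarrow> nat \<Rightarrow> bool" where
  "compressed_gorenstein I j \<longleftrightarrow> gorenstein_quotient I j \<and>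
     (\<forall>i\<le>j. hilbert_fun I i =
        min (dim_k (forms i :: 'k poly4 set)) (dim_k (forms (j - i) :: 'k poly4 set)))"

end

theory Submission
  imports Defs "HOL-Analysis.Cartesian_Space"
begin

text \<open>
  Write \<open>Q = x\<^sup>T A x\<close> with \<open>A\<close> symmetric and invertible, let \<open>B\<close> be the inverse of \<open>A\<close>, let \<open>q\<close> be the
  dual quadric \<open>x\<^sup>T B x\<close>, and call a form harmonic if \<open>Q(\<partial>)\<close> kills it. From
  \<open>Q(\<partial>) q = q Q(\<partial>) + 4 E + 8\<close> (\<open>E\<close> the Euler operator) one gets \<open>R\<^sub>e = H\<^sub>e \<oplus> q R\<^bsub>e-2\<^esub>\<close> for the spaces \<open>H\<^sub>e\<close> of
  harmonic forms, and \<open>q H\<^sub>d\<close> lies in the ideal of \<open>H\<^bsub>d+1\<^esub>\<close>. Hence, for \<open>m \<ge> 1\<close>, every form of degree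
  \<open>t + m\<close> is congruent to some \<open>q\<^sup>m g\<close> with \<open>g\<close> of degree \<open>t - m\<close> modulo the ideal of \<open>H\<^bsub>t+1\<^esub>\<close>, which
  annihilates \<open>Q\<^sup>t\<close>. The derivatives of \<open>Q\<^sup>t\<close> exhaust the forms of degree at most \<open>t\<close>, so by duality no
  nonzero form of degree at most \<open>t\<close> annihilates \<open>Q\<^sup>t\<close>; since \<open>q\<^sup>m(\<partial>) Q\<^sup>t\<close> is a nonzero multiple of
  \<open>Q\<^bsup>t-m\<^esup>\<close>, this forces \<open>g = 0\<close> in the annihilator. Thus \<open>(Q\<^sup>t)\<^sup>\<bottom>\<close> is the ideal of \<open>H\<^bsub>t+1\<^esub>\<close>, and compressedness
  follows as well. Finally \<open>H\<^sub>d\<close> is spanned by the powers \<open>l\<^sup>d\<close> of isotropic linear forms: a functional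
  killing these powers is given by a form \<open>F\<close> that vanishes on the zero set of \<open>Q\<close>, hence is divisible by
  \<open>Q\<close>, hence kills \<open>H\<^sub>d\<close>.
\<close>


section \<open>Polynomials in four variables\<close>

definition cst :: "'k::comm_ring_1 \<Rightarrow> 'k poly4" where
  "cst c = Poly_Mapping.single 0 c"

lemma cst_simps [simp]: "cst 0 = 0" "cst 1 = 1"
  by (simp_all add: cst_def)

lemma cst_add: "cst (a + b) = cst a + cst b"
  and cst_mult: "cst (a * b) = cst a * cst b"
  and cst_of_nat: "cst (of_nat n) = of_nat n"
  and cst_numeral: "cst (numeral w) = numeral w"
  by (simp_all add: cst_def single_add mult_single)

lemma cst_sum: "cst (sum f S) = (\<Sum>x\<in>S. cst (f x))"
  by (induction S rule: infinite_finite_induct) (simp_all add: cst_add)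

lemma cst_eq_iff [simp]: "cst a = cst b \<longleftrightarrow> a = b"
  by (auto simp: cst_def dest: injD[OF inj_single])

lemma smul_cst: "smul c F = cst c * F"
  by (simp add: smul_def cst_def)

lemma cst_inverse_mult: "(c::'k::field) \<noteq> 0 \<Longrightarrow> cst c * (cst (inverse c) * F) = F"
  by (simp flip: cst_mult mult.assoc)

lemma single_var_mult: "Poly_Mapping.single (Poly_Mapping.single i 1 + m) c = var i * Poly_Mapping.single m c"
  by (simp add: var_def mult_single)

lemma poly_mapping_sum_single: "(\<Sum>m\<in>Poly_Mapping.keys F. Poly_Mapping.single m (Poly_Mapping.lookup F m)) = F"
proof (rule poly_mapping_eqI)
  fix k
  have "(\<Sum>m\<in>Poly_Mapping.keys F. Poly_Mapping.lookup (Poly_Mapping.single m (Poly_Mapping.lookup F m)) k)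
      = (\<Sum>m\<in>Poly_Mapping.keys F. if m = k then Poly_Mapping.lookup F m else 0)"
    by (intro sum.cong) (auto simp: lookup_single when_def)
  also have "\<dots> = Poly_Mapping.lookup F k"
    by (simp add: in_keys_iff)
  finally show "Poly_Mapping.lookup (\<Sum>m\<in>Poly_Mapping.keys F. Poly_Mapping.single m (Poly_Mapping.lookup F m)) k
    = Poly_Mapping.lookup F k"
    by (simp add: lookup_sum)
qed

lemma expo_degree_add: "expo_degree (m + n) = expo_degree m + expo_degree n"
  by (simp add: expo_degree_def lookup_add sum.distrib)

lemma expo_degree_single [simp]: "expo_degree (Poly_Mapping.single i n) = n"
  by (simp add: expo_degree_def lookup_single when_def)

lemma expo_degree_zero [simp]: "expo_degree 0 = 0"
  by (simp add: expo_degree_def)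

lemma expo_degree_eq_0_iff: "expo_degree m = 0 \<longleftrightarrow> m = 0"
  by (auto simp: expo_degree_def intro!: poly_mapping_eqI)

lemma expo_split:
  assumes "Poly_Mapping.lookup (m::expo4) i > 0"
  shows "m = Poly_Mapping.single i 1 + (m - Poly_Mapping.single i 1)"
  using assms by (intro poly_mapping_eqI) (auto simp: lookup_add lookup_minus lookup_single when_def)

lemma expo_induct [case_names zero add_single]:
  assumes "P 0" and "\<And>i m. P m \<Longrightarrow> P (Poly_Mapping.single i 1 + m)"
  shows "P (m::expo4)"
proof (induction "expo_degree m" arbitrary: m)
  case 0
  with assms(1) show ?case by (simp add: expo_degree_eq_0_iff)
next
  case (Suc d)
  then obtain i where "Poly_Mapping.lookup m i > 0"
    by (metis expo_degree_def gr0I nat.distinct(1) sum.neutral)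
  from expo_split[OF this] obtain m' where m': "m = Poly_Mapping.single i 1 + m'" by blast
  with Suc have "d = expo_degree m'" by (simp add: expo_degree_add)
  with Suc m' assms(2) show ?case by blast
qed

lemma poly4_single_induct [case_names single add]:
  fixes F :: "'k::comm_ring_1 poly4"
  assumes "\<And>m c. P (Poly_Mapping.single m c)" and "\<And>F G. P F \<Longrightarrow> P G \<Longrightarrow> P (F + G)"
  shows "P F"
proof -
  have "P (\<Sum>m\<in>S. Poly_Mapping.single m (Poly_Mapping.lookup F m))" if "finite S" for S
    using that by induction (use assms(1)[of 0 0] assms in auto)
  from this[OF finite_keys[of F]] show ?thesis
    unfolding poly_mapping_sum_single .
qed

text \<open>Reduces an identity between additive operators to constants and to multiplication by a
  single variable, the two cases in which derivatives and substitutions have simple rules.\<close>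

lemma poly4_induct [case_names cst var_mult add]:
  assumes "\<And>c. P (cst c)" and "\<And>i F. P F \<Longrightarrow> P (var i * F)" and "\<And>F G. P F \<Longrightarrow> P G \<Longrightarrow> P (F + G)"
  shows "P F"
proof (induction F rule: poly4_single_induct)
  case (single m c)
  show ?case
  proof (induction m rule: expo_induct)
    case zero
    show ?case using assms(1)[of c] by (simp add: cst_def)
  next
    case (add_single i m)
    then show ?case unfolding single_var_mult by (rule assms(2))
  qed
qed (rule assms(3))

lemma sum_keys_superset:
  assumes "\<And>m. f m 0 = 0" "finite S" "Poly_Mapping.keys F \<subseteq> S"
  shows "(\<Sum>m\<in>Poly_Mapping.keys F. f m (Poly_Mapping.lookup F m)) = (\<Sum>m\<in>S. f m (Poly_Mapping.lookup F m))"
  using assms by (intro sum.mono_neutral_left) (auto simp: in_keys_iff)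

text \<open>Evaluation, derivatives and the operator action are all sums over \<open>keys\<close>.
  Cancellation can make the keys of \<open>F + G\<close> smaller than the union of both key sets, so
  all three sums are first extended to that union.\<close>

lemma sum_keys_add:
  fixes F G :: "'a \<Rightarrow>\<^sub>0 'b::comm_monoid_add"
  assumes "\<And>m. f m 0 = 0" "\<And>m a b. f m (a + b) = f m a + f m b"
  shows "(\<Sum>m\<in>Poly_Mapping.keys (F + G). f m (Poly_Mapping.lookup (F + G) m))
    = (\<Sum>m\<in>Poly_Mapping.keys F. f m (Poly_Mapping.lookup F m))
    + (\<Sum>m\<in>Poly_Mapping.keys G. f m (Poly_Mapping.lookup G m))"
proof -
  let ?S = "Poly_Mapping.keys F \<union> Poly_Mapping.keys G"
  have "(\<Sum>m\<in>Poly_Mapping.keys H. f m (Poly_Mapping.lookup H m)) = (\<Sum>m\<in>?S. f m (Poly_Mapping.lookup H m))"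
    if "Poly_Mapping.keys H \<subseteq> ?S" for H
    by (rule sum_keys_superset) (use assms that in auto)
  from this[of "F + G"] this[of F] this[of G] show ?thesis
    using Poly_Mapping.keys_add[of F G] by (simp add: lookup_add assms sum.distrib)
qed

lemma sum_keys_single:
  "f m 0 = 0 \<Longrightarrow> (\<Sum>n\<in>Poly_Mapping.keys (Poly_Mapping.single m c). f n (Poly_Mapping.lookup (Poly_Mapping.single m c) n)) = f m c"
  by (cases "c = 0") auto

section \<open>Substitution homomorphisms\<close>

text \<open>Here \<open>h\<close> maps the coefficients and \<open>v\<close> gives the images of the
  variables. The instances are evaluation at a point, restriction to a line with values in
  univariate polynomials, and the substitution that parametrizes the quadric.\<close>

locale insertion4 =
  fixes h :: "'k::comm_ring_1 \<Rightarrow> 'b::comm_ring_1" and v :: "4 \<Rightarrow> 'b"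
  assumes h_0: "h 0 = 0" and h_1: "h 1 = 1"
    and h_add: "h (a + b) = h a + h b" and h_mult: "h (a * b) = h a * h b"
begin

definition ins :: "'k poly4 \<Rightarrow> 'b" where
  "ins F = (\<Sum>m\<in>Poly_Mapping.keys F. h (Poly_Mapping.lookup F m) * (\<Prod>i\<in>UNIV. v i ^ Poly_Mapping.lookup m i))"

lemma ins_single: "ins (Poly_Mapping.single m c) = h c * (\<Prod>i\<in>UNIV. v i ^ Poly_Mapping.lookup m i)"
  unfolding ins_def by (rule sum_keys_single) (simp add: h_0)

lemma ins_add: "ins (F + G) = ins F + ins G"
  unfolding ins_def by (rule sum_keys_add) (simp_all add: h_0 h_add distrib_right)

lemma ins_cst: "ins (cst c) = h c"
  by (simp add: cst_def ins_single)

lemma ins_0 [simp]: "ins 0 = 0"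
  by (simp add: ins_def)

lemma prod_power_single: "(\<Prod>j\<in>UNIV. v j ^ Poly_Mapping.lookup (Poly_Mapping.single i 1) j) = v i"
proof -
  have "(\<Prod>j\<in>UNIV. v j ^ Poly_Mapping.lookup (Poly_Mapping.single i 1) j) = (\<Prod>j\<in>UNIV. if j = i then v j else 1)"
    by (intro prod.cong) (auto simp: lookup_single when_def)
  then show ?thesis by simp
qed

lemma ins_var: "ins (var i) = v i"
  unfolding var_def by (simp only: ins_single prod_power_single h_1) simp

lemma ins_var_mult: "ins (var i * F) = v i * ins F"
proof -
  have *: "ins (var i * Poly_Mapping.single m c) = v i * ins (Poly_Mapping.single m c)" for m c
    unfolding single_var_mult[symmetric]
    by (simp only: ins_single lookup_add power_add prod.distrib prod_power_single) (simp add: mult_ac)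
  show ?thesis
    by (induction F rule: poly4_single_induct) (simp_all only: * ins_add distrib_left)
qed

lemma ins_cst_mult: "ins (cst c * F) = h c * ins F"
proof (induction F rule: poly4_induct)
  case (cst d)
  show ?case by (simp add: ins_cst h_mult flip: cst_mult)
next
  case (var_mult i F)
  then show ?case by (simp only: mult.left_commute[of "cst c" "var i"] ins_var_mult mult.left_commute[of "h c" "v i"])
next
  case (add F G)
  then show ?case by (simp add: distrib_left ins_add)
qed

lemma ins_mult: "ins (F * G) = ins F * ins G"
  by (induction F rule: poly4_induct)
    (simp_all add: ins_cst_mult ins_cst mult.assoc ins_var_mult ins_add distrib_right)

lemma ins_uminus: "ins (- F) = - ins F"
  by (metis add.right_inverse add_eq_0_iff2 ins_0 ins_add neg_eq_iff_add_eq_0)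

lemma ins_diff: "ins (F - G) = ins F - ins G"
  using ins_add[of F "- G"] by (simp add: ins_uminus)

lemma ins_sum: "ins (sum f S) = (\<Sum>x\<in>S. ins (f x))"
  by (induction S rule: infinite_finite_induct) (simp_all add: ins_add)

end

interpretation ev: insertion4 "\<lambda>c. c" v
  rewrites "insertion4.ins (\<lambda>c. c) v = eval4 v" for v :: "4 \<Rightarrow> 'k::comm_ring_1"
proof -
  show *: "insertion4 (\<lambda>c::'k. c)" by unfold_locales auto
  show "insertion4.ins (\<lambda>c. c) v = eval4 v"
    by (rule ext) (simp add: insertion4.ins_def[OF *] eval4_def)
qed

section \<open>Partial derivatives and the Euler operator\<close>

lemma partial_single:
  "partial i (Poly_Mapping.single m c) = Poly_Mapping.single (m - Poly_Mapping.single i 1) (of_nat (Poly_Mapping.lookup m i) * c)"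
  unfolding partial_def by (rule sum_keys_single) simp

lemma partial_add: "partial i (F + G) = partial i F + partial i G"
  unfolding partial_def by (rule sum_keys_add) (simp_all add: distrib_left single_add)

lemma partial_0 [simp]: "partial i 0 = 0"
  by (simp add: partial_def)

lemma partial_cst [simp]: "partial i (cst c) = 0"
  by (simp add: cst_def partial_single)

lemma partial_sum: "partial i (sum f S) = (\<Sum>x\<in>S. partial i (f x))"
  by (induction S rule: infinite_finite_induct) (simp_all add: partial_add)

text \<open>This commutation rule is the only place where monomials and the truncated subtraction of
  exponents have to be examined; the product rule and the commutation of derivatives follow by
  \<open>poly4_induct\<close>.\<close>

lemma partial_var_mult: "partial i (var j * F) = (if i = j then F else 0) + var j * partial i F"
proof -
  have *: "partial i (var j * Poly_Mapping.single m c) = (if i = j then Poly_Mapping.single m c else 0)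
      + var j * partial i (Poly_Mapping.single m c)" for m and c :: 'a
  proof (cases "i = j")
    case True
    show ?thesis
    proof (cases "Poly_Mapping.lookup m i = 0")
      case True
      with \<open>i = j\<close> show ?thesis
        unfolding single_var_mult[symmetric] partial_single
        by (simp add: lookup_add lookup_single)
    next
      case False
      then have m: "Poly_Mapping.single i 1 + (m - Poly_Mapping.single i 1) = m"
        using expo_split[of m i] by simp
      have "var i * Poly_Mapping.single (m - Poly_Mapping.single i 1) d = Poly_Mapping.single m d" for d :: 'a
        unfolding single_var_mult[symmetric] m ..
      then show ?thesis using \<open>i = j\<close>
        unfolding single_var_mult[symmetric] partial_single
        by (simp add: lookup_add lookup_single distrib_right single_add)
    qed
  next
    case False
    show ?thesis
    proof (cases "Poly_Mapping.lookup m i = 0")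
      case True
      with False show ?thesis
        unfolding single_var_mult[symmetric] partial_single
        by (simp add: lookup_add lookup_single)
    next
      case pos: False
      have "Poly_Mapping.single j 1 + m - Poly_Mapping.single i 1 = Poly_Mapping.single j 1 + (m - Poly_Mapping.single i 1)"
        using False pos by (intro poly_mapping_eqI) (auto simp: lookup_add lookup_minus lookup_single when_def)
      with False show ?thesis
        unfolding single_var_mult[symmetric] partial_single
        by (simp add: lookup_add lookup_single single_var_mult)
    qed
  qed
  show ?thesis
    by (induction F rule: poly4_single_induct) (simp_all add: * partial_add distrib_left)
qed

lemma partial_cst_mult: "partial i (cst c * F) = cst c * partial i F"
proof (induction F rule: poly4_induct)
  case (cst d)
  show ?case by (simp flip: cst_mult)
next
  case (var_mult j F)
  then show ?case by (simp add: mult.left_commute[of "cst c" "var j"] partial_var_mult distrib_left)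
next
  case (add F G)
  then show ?case by (simp add: distrib_left partial_add)
qed

lemma partial_mult: "partial i (F * G) = partial i F * G + F * partial i G"
proof (induction F rule: poly4_induct)
  case (cst c)
  then show ?case by (simp add: partial_cst_mult)
next
  case (var_mult j F)
  then show ?case by (simp add: mult.assoc partial_var_mult distrib_left distrib_right)
next
  case (add F G)
  then show ?case by (simp add: algebra_simps partial_add)
qed

lemma partial_1 [simp]: "partial i 1 = 0"
  using partial_cst[of i 1] by simp

lemma partial_var: "partial i (var j) = (if i = j then 1 else 0)"
  using partial_var_mult[of i j 1] by simp

lemma partial_commute: "partial i (partial j F) = partial j (partial i F)"
  by (induction F rule: poly4_induct) (simp_all add: partial_var_mult partial_add)

lemma partial_power: "partial i (F ^ Suc n) = of_nat (Suc n) * F ^ n * partial i F"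
  by (induction n) (simp_all add: partial_mult algebra_simps)

definition euler :: "'k::comm_ring_1 poly4 \<Rightarrow> 'k poly4" where
  "euler F = (\<Sum>i\<in>UNIV. var i * partial i F)"

lemma euler_add: "euler (F + G) = euler F + euler G"
  by (simp add: euler_def partial_add algebra_simps sum.distrib)

lemma euler_mult: "euler (F * G) = euler F * G + F * euler G"
  by (simp add: euler_def partial_mult algebra_simps sum.distrib sum_distrib_left sum_distrib_right)

lemma euler_cst [simp]: "euler (cst c) = 0"
  by (simp add: euler_def)

lemma euler_var [simp]: "euler (var i) = var i"
  by (simp add: euler_def partial_var if_distrib[of "\<lambda>x. _ * x"] cong: if_cong)

lemma lookup_euler: "Poly_Mapping.lookup (euler F) m = of_nat (expo_degree m) * Poly_Mapping.lookup F m"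
proof -
  have *: "euler (Poly_Mapping.single m c) = of_nat (expo_degree m) * Poly_Mapping.single m c" for m :: expo4 and c :: 'a
  proof (induction m rule: expo_induct)
    case zero
    show ?case using euler_cst[of c] by (simp add: cst_def)
  next
    case (add_single i m)
    then show ?case unfolding single_var_mult by (simp add: euler_mult expo_degree_add algebra_simps)
  qed
  show ?thesis
  proof (induction F rule: poly4_single_induct)
    case (single n c)
    have "Poly_Mapping.lookup (of_nat (expo_degree n) * Poly_Mapping.single n c) m
      = of_nat (expo_degree m) * Poly_Mapping.lookup (Poly_Mapping.single n c) m"
      by (cases "n = m") (auto simp: mult_single lookup_single simp flip: single_of_nat)
    then show ?case by (simp only: *)
  next
    case (add F G)
    then show ?case by (simp add: euler_add lookup_add distrib_left)
  qed
qed

text \<open>Monomials are eigenvectors of the Euler operator with their degree as eigenvalue, and in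
  characteristic zero distinct degrees give distinct eigenvalues.\<close>

lemma forms_iff_euler:
  fixes F :: "'k::field_char_0 poly4"
  shows "F \<in> forms d \<longleftrightarrow> euler F = of_nat d * F"
proof -
  have "Poly_Mapping.lookup (cst c * F) m = c * Poly_Mapping.lookup F m" for c m
    unfolding cst_def mult_map_scale_conv_mult[symmetric]
    by (simp add: Poly_Mapping.map.rep_eq when_def)
  from this[of "of_nat d"] have "Poly_Mapping.lookup (of_nat d * F) m = of_nat d * Poly_Mapping.lookup F m" for m
    by (simp add: cst_of_nat)
  then have "euler F = of_nat d * F \<longleftrightarrow> (\<forall>m. of_nat (expo_degree m) * Poly_Mapping.lookup F m = of_nat d * Poly_Mapping.lookup F m)"
    by (auto simp: poly_mapping_eq_iff lookup_euler fun_eq_iff)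
  also have "\<dots> \<longleftrightarrow> F \<in> forms d"
    by (auto simp: forms_def in_keys_iff)
  finally show ?thesis by simp
qed

section \<open>The differential operator action on forms\<close>

lemma partial_expo_add: "partial_expo m (F + G) = partial_expo m F + partial_expo m G"
proof -
  have "(partial i ^^ n) (F + G) = (partial i ^^ n) F + (partial i ^^ n) G" for i n and F G :: "'a poly4"
    by (induction n) (simp_all add: partial_add)
  then show ?thesis by (simp add: partial_expo_def)
qed

text \<open>Since partial derivatives commute, the fixed order of differentiation in
  \<open>partial_expo\<close> is immaterial.\<close>

lemma partial_expo_add_single: "partial_expo (Poly_Mapping.single i 1 + m) F = partial i (partial_expo m F)"
proof -
  have comm: "(partial j ^^ n) (partial k F) = partial k ((partial j ^^ n) F)" for j k n and F :: "'a poly4"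
    by (induction n) (simp_all add: partial_commute[of k])
  show ?thesis
    using exhaust_4[of i] by (auto simp: partial_expo_def lookup_add lookup_single comm)
qed

lemma diff_by_add_right: "diff_by F (G + G') = diff_by F G + diff_by F G'"
  unfolding diff_by_def by (rule sum_keys_add) (simp_all add: smul_cst cst_add distrib_right)

lemma diff_by_single: "diff_by F (Poly_Mapping.single m c) = cst c * partial_expo m F"
  unfolding diff_by_def smul_cst by (rule sum_keys_single) simp

lemma diff_by_add_left: "diff_by (F + F') G = diff_by F G + diff_by F' G"
  by (induction G rule: poly4_single_induct)
    (simp_all add: diff_by_single diff_by_add_right partial_expo_add distrib_left)

lemma diff_by_cst [simp]: "diff_by F (cst c) = cst c * F"
  unfolding cst_def[of c] diff_by_single by (simp add: partial_expo_def cst_def)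

lemma diff_by_1 [simp]: "diff_by F 1 = F"
  using diff_by_cst[of F 1] by simp

lemma diff_by_0 [simp]: "diff_by F 0 = 0" "diff_by 0 G = 0"
  using diff_by_cst[of F 0] diff_by_add_left[of 0 0 G] by simp_all

lemma diff_by_var_mult: "diff_by F (var i * G) = partial i (diff_by F G)"
proof (induction G rule: poly4_single_induct)
  case (single m c)
  show ?case
    unfolding single_var_mult[symmetric] diff_by_single partial_expo_add_single
    by (simp add: partial_cst_mult)
next
  case (add F G)
  then show ?case by (simp add: distrib_left diff_by_add_right partial_add)
qed

lemma diff_by_cst_mult_right: "diff_by F (cst c * G) = cst c * diff_by F G"
proof (induction G rule: poly4_induct)
  case (cst d)
  show ?case by (simp add: mult.assoc flip: cst_mult) (simp add: cst_mult mult.assoc)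
next
  case (var_mult i G)
  then show ?case by (simp add: mult.left_commute[of "cst c" "var i"] diff_by_var_mult partial_cst_mult)
next
  case (add F G)
  then show ?case by (simp add: distrib_left diff_by_add_right)
qed

text \<open>Products of operators act by composition, so the polynomial ring becomes a module over
  itself by differentiation. This makes annihilators ideals.\<close>

lemma diff_by_mult: "diff_by F (G * H) = diff_by (diff_by F H) G"
  by (induction G rule: poly4_induct)
    (simp_all add: diff_by_cst_mult_right mult.assoc diff_by_var_mult distrib_right diff_by_add_right)

lemma diff_by_mult_commute: "diff_by F (G * H) = diff_by (diff_by F G) H"
  using diff_by_mult[of F H G] by (simp add: mult.commute)

lemma diff_by_var [simp]: "diff_by F (var i) = partial i F"
  using diff_by_var_mult[of F i 1] by simp

lemma diff_by_cst_mult_left: "diff_by (cst c * F) G = cst c * diff_by F G"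
  using diff_by_mult[of F G "cst c"] diff_by_cst_mult_right[of F c G] by (simp add: mult.commute)

lemma diff_by_numeral_mult_right: "diff_by F (numeral w * G) = numeral w * diff_by F G"
  using diff_by_cst_mult_right[of F "numeral w" G] by (simp add: cst_numeral)

lemma diff_by_numeral_mult_left: "diff_by (numeral w * F) G = numeral w * diff_by F G"
  using diff_by_cst_mult_left[of "numeral w" F G] by (simp add: cst_numeral)

lemma diff_by_numeral [simp]: "diff_by F (numeral w) = numeral w * F"
  using diff_by_cst[of F "numeral w"] by (simp add: cst_numeral)

lemma diff_by_partial: "diff_by (partial i F) G = partial i (diff_by F G)"
  using diff_by_mult[of F G "var i"] diff_by_var_mult[of F i G] by (simp add: mult.commute)

lemma diff_by_sum_right: "diff_by F (sum g S) = (\<Sum>x\<in>S. diff_by F (g x))"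
  by (induction S rule: infinite_finite_induct) (simp_all add: diff_by_add_right)

lemma diff_by_sum_left: "diff_by (sum g S) F = (\<Sum>x\<in>S. diff_by (g x) F)"
  by (induction S rule: infinite_finite_induct) (simp_all add: diff_by_add_left)

lemma diff_by_uminus_right: "diff_by F (- G) = - diff_by F G"
  by (metis add.right_inverse add_eq_0_iff2 diff_by_0(1) diff_by_add_right neg_eq_iff_add_eq_0)

lemma diff_by_diff_right: "diff_by F (G - G') = diff_by F G - diff_by F G'"
  using diff_by_add_right[of F G "- G'"] by (simp add: diff_by_uminus_right)

lemma diff_by_diff_left: "diff_by (F - F') G = diff_by F G - diff_by F' G"
  using diff_by_add_left[of "F - F'" F' G] by simp

text \<open>The Weyl algebra relation: moving an operator past multiplication by a variable costs
  the derivative of the operator itself.\<close>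

lemma diff_by_times_var: "diff_by (var k * F) G = var k * diff_by F G + diff_by F (partial k G)"
proof (induction G rule: poly4_induct)
  case (cst c)
  show ?case by (simp add: ac_simps)
next
  case (var_mult i G)
  then show ?case
    by (auto simp: diff_by_var_mult partial_var_mult partial_add diff_by_add_right add_ac)
next
  case (add F G)
  then show ?case by (simp add: diff_by_add_right partial_add algebra_simps)
qed

section \<open>Graded pieces and homogeneous components\<close>

lemma forms_0 [simp]: "0 \<in> forms d"
  by (simp add: forms_def)

lemma forms_add: "F \<in> forms d \<Longrightarrow> G \<in> forms d \<Longrightarrow> F + G \<in> forms d"
  using Poly_Mapping.keys_add[of F G] by (auto simp: forms_def)

lemma forms_sum: "(\<And>x. x \<in> S \<Longrightarrow> g x \<in> forms d) \<Longrightarrow> sum g S \<in> forms d"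
  by (induction S rule: infinite_finite_induct) (auto intro: forms_add)

lemma forms_mult: "F \<in> forms d \<Longrightarrow> G \<in> forms e \<Longrightarrow> F * G \<in> forms (d + e)"
  unfolding forms_def using Poly_Mapping.keys_mult[of F G] by (fastforce simp: expo_degree_add)

lemma forms_single: "Poly_Mapping.single m c \<in> forms (expo_degree m)"
  by (simp add: forms_def)

lemma forms_cst: "cst c \<in> forms 0"
  using forms_single[of 0 c] by (simp add: cst_def)

lemma forms_cst_mult: "F \<in> forms d \<Longrightarrow> cst c * F \<in> forms d"
  using forms_mult[OF forms_cst[of c]] by fastforce

lemma forms_var: "var i \<in> forms 1"
  by (simp add: forms_def var_def)

lemma forms_var_mult: "F \<in> forms d \<Longrightarrow> var i * F \<in> forms (Suc d)"
  using forms_mult[OF forms_var[of i]] by fastforce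

lemma forms_power: "F \<in> forms d \<Longrightarrow> F ^ n \<in> forms (n * d)"
  by (induction n) (auto intro: forms_mult simp: forms_cst[of 1, simplified])

lemma forms_uminus: "F \<in> forms d \<Longrightarrow> - F \<in> forms d"
  by (auto simp: forms_def in_keys_iff)

lemma forms_diff: "F \<in> forms d \<Longrightarrow> G \<in> forms d \<Longrightarrow> F - G \<in> forms d"
  using forms_add[of F d "- G"] by (simp add: forms_uminus)

lemma forms_partial:
  assumes "F \<in> forms (Suc d)" shows "partial i F \<in> forms d"
proof -
  have "partial i (Poly_Mapping.single m c) \<in> forms d" if "expo_degree m = Suc d" for m and c :: 'a
  proof (cases "Poly_Mapping.lookup m i = 0")
    case False
    then have "expo_degree m = Suc (expo_degree (m - Poly_Mapping.single i 1))"
      using expo_degree_add[of "Poly_Mapping.single i 1" "m - Poly_Mapping.single i 1"] expo_split[of m i] by simp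
    with that show ?thesis unfolding partial_single by (metis forms_single old.nat.inject)
  qed (simp add: partial_single)
  then have "partial i (\<Sum>m\<in>Poly_Mapping.keys F. Poly_Mapping.single m (Poly_Mapping.lookup F m)) \<in> forms d"
    unfolding partial_sum using assms by (intro forms_sum) (auto simp: forms_def)
  then show ?thesis unfolding poly_mapping_sum_single .
qed

lemma forms_0_cst:
  assumes "F \<in> forms 0" obtains c where "F = cst c"
proof
  show "F = cst (Poly_Mapping.lookup F 0)"
    using assms by (intro poly_mapping_eqI)
      (auto simp: cst_def lookup_single when_def forms_def in_keys_iff expo_degree_eq_0_iff)
qed

lemma forms_0_partial: "F \<in> forms 0 \<Longrightarrow> partial i F = 0"
  by (auto elim: forms_0_cst)

lemma forms_partial_diff: "F \<in> forms d \<Longrightarrow> partial i F \<in> forms (d - 1)"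
  using forms_partial[of F "d - 1" i] by (cases d) (auto simp: forms_0_partial)

text \<open>The zero polynomial lies in every graded piece, and an empty sum of monomials carries no
  degree; hence the separate assumption \<open>zero\<close>.\<close>

lemma forms_induct [consumes 1, case_names cst var_mult add]:
  assumes "F \<in> forms d"
    and "\<And>c. P 0 (cst c)"
    and "\<And>d i F. F \<in> forms d \<Longrightarrow> P d F \<Longrightarrow> P (Suc d) (var i * F)"
    and "\<And>d F G. F \<in> forms d \<Longrightarrow> G \<in> forms d \<Longrightarrow> P d F \<Longrightarrow> P d G \<Longrightarrow> P d (F + G)"
    and zero: "\<And>d. P d 0"
  shows "P d F"
proof -
  have single: "P (expo_degree m) (Poly_Mapping.single m c)" for m c
  proof (induction m rule: expo_induct)
    case zero
    show ?case using assms(2)[of c] by (simp add: cst_def)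
  next
    case (add_single i m)
    then show ?case unfolding single_var_mult
      using assms(3)[OF forms_single] by (simp add: expo_degree_add)
  qed
  have "P d (\<Sum>m\<in>S. Poly_Mapping.single m (Poly_Mapping.lookup F m)) \<and>
      (\<Sum>m\<in>S. Poly_Mapping.single m (Poly_Mapping.lookup F m)) \<in> forms d"
    if "finite S" "S \<subseteq> Poly_Mapping.keys F" for S
    using that
  proof induction
    case empty
    then show ?case using zero by simp
  next
    case (insert m S)
    then have "expo_degree m = d" using assms(1) by (auto simp: forms_def)
    with insert single forms_single show ?case
      by (auto intro!: assms(4) forms_add)
  qed
  from this[of "Poly_Mapping.keys F"] show ?thesis by (simp add: poly_mapping_sum_single)
qed

lemma diff_by_forms:
  assumes "F \<in> forms (d + e)" "G \<in> forms d" shows "diff_by F G \<in> forms e"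
  using assms(2,1)
proof (induction G arbitrary: e rule: forms_induct)
  case (cst c)
  then show ?case by (simp add: forms_cst_mult)
next
  case (var_mult d i G)
  then show ?case by (simp add: diff_by_var_mult forms_partial)
next
  case (add d F G)
  then show ?case by (simp add: diff_by_add_right forms_add)
qed simp

lemma diff_by_forms_0:
  assumes "F \<in> forms e" "G \<in> forms d" "e < d" shows "diff_by F G = 0"
  using assms(2,1,3)
proof (induction G arbitrary: e rule: forms_induct)
  case (var_mult d i G)
  show ?case
  proof (cases "e = d")
    case True
    then have "diff_by F G \<in> forms 0" using var_mult by (simp add: diff_by_forms)
    then show ?thesis by (simp add: diff_by_var_mult forms_0_partial)
  qed (use var_mult in \<open>simp add: diff_by_var_mult\<close>)
qed (auto simp: diff_by_add_right)

definition hcomp :: "nat \<Rightarrow> 'k::comm_ring_1 poly4 \<Rightarrow> 'k poly4" where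
  "hcomp d F = (\<Sum>m\<in>Poly_Mapping.keys F. Poly_Mapping.single m (Poly_Mapping.lookup F m when expo_degree m = d))"

lemma hcomp_add: "hcomp d (F + G) = hcomp d F + hcomp d G"
  unfolding hcomp_def
  by (rule sum_keys_add[of "\<lambda>m c. Poly_Mapping.single m (c when expo_degree m = d)"])
    (simp_all add: single_add when_add_distrib)

lemma hcomp_0 [simp]: "hcomp d 0 = 0"
  by (simp add: hcomp_def)

lemma hcomp_in_forms [simp]: "hcomp d F \<in> forms d"
  unfolding hcomp_def by (intro forms_sum) (auto simp: when_def forms_single)

lemma hcomp_forms: "F \<in> forms e \<Longrightarrow> hcomp d F = (if d = e then F else 0)"
proof -
  assume F: "F \<in> forms e"
  have "hcomp d F = (\<Sum>m\<in>Poly_Mapping.keys F. if d = e then Poly_Mapping.single m (Poly_Mapping.lookup F m) else 0)"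
    unfolding hcomp_def using F by (intro sum.cong) (auto simp: forms_def)
  then show ?thesis by (simp add: poly_mapping_sum_single)
qed

text \<open>Asking for all large \<open>n\<close>, instead of one, lets the bounds of two summands
  be replaced by their maximum.\<close>

lemma hcomp_decompose: "\<exists>N. \<forall>n\<ge>N. F = (\<Sum>d<n. hcomp d F)"
proof (induction F rule: poly4_single_induct)
  case (single m c)
  have "(\<Sum>d<n. hcomp d (Poly_Mapping.single m c)) = Poly_Mapping.single m c" if "n > expo_degree m" for n
    using that by (simp add: hcomp_forms[OF forms_single])
  then show ?case by (metis less_eq_Suc_le)
next
  case (add F G)
  then obtain N N' where "\<forall>n\<ge>N. F = (\<Sum>d<n. hcomp d F)" "\<forall>n\<ge>N'. G = (\<Sum>d<n. hcomp d G)" by blast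
  then have "\<forall>n\<ge>max N N'. F + G = (\<Sum>d<n. hcomp d (F + G))"
    by (simp add: hcomp_add sum.distrib)
  then show ?case by blast
qed

lemma hcomp_mult:
  assumes "G \<in> forms e"
  shows "hcomp (d + e) (F * G) = hcomp d F * G"
proof (induction F rule: poly4_single_induct)
  case (single m c)
  show ?case
    using hcomp_forms[OF forms_mult[OF forms_single[of m c] assms], of "d + e"]
    by (auto simp: hcomp_forms[OF forms_single])
qed (simp add: hcomp_add distrib_right)

section \<open>Euler's identity and the apolarity pairing\<close>

lemma euler_forms:
  fixes F :: "'k::field_char_0 poly4"
  shows "F \<in> forms d \<Longrightarrow> (\<Sum>i\<in>UNIV. var i * partial i F) = of_nat d * F"
  using forms_iff_euler[of F d] by (simp add: euler_def)

lemma of_nat_inverse_mult: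
  fixes F :: "'k::field_char_0 poly4"
  shows "n \<noteq> 0 \<Longrightarrow> of_nat n * (cst (inverse (of_nat n)) * F) = F"
  using cst_inverse_mult[of "of_nat n :: 'k" F] by (simp only: cst_of_nat) simp

lemma of_nat_mult_eq_0_iff:
  fixes F :: "'k::field_char_0 poly4"
  shows "of_nat n * F = 0 \<longleftrightarrow> n = 0 \<or> F = 0"
proof -
  have "F = 0" if "of_nat n * F = 0" "n \<noteq> 0"
    using cst_inverse_mult[of "of_nat n :: 'k" F] that
    by (simp add: cst_of_nat mult.left_commute[of "of_nat n"])
  then show ?thesis by auto
qed

lemma forms_eqI_partial:
  fixes F :: "'k::field_char_0 poly4"
  assumes "F \<in> forms (Suc d)" "\<And>i. partial i F = 0" shows "F = 0"
  using euler_forms[OF assms(1)] assms(2) of_nat_mult_eq_0_iff[of "Suc d" F] by simp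

text \<open>In equal degrees the action is the apolarity pairing, with constant values. Euler's
  identity for \<open>F\<close> turns the pairing in degree \<open>d + 1\<close> into a sum of
  pairings of partial derivatives in degree \<open>d\<close>, where induction applies.\<close>

lemma diff_by_symmetric:
  fixes F G :: "'k::field_char_0 poly4"
  assumes "F \<in> forms d" "G \<in> forms d"
  shows "diff_by F G = diff_by G F"
  using assms
proof (induction d arbitrary: F G)
  case 0
  then show ?case by (auto elim!: forms_0_cst simp: mult.commute)
next
  case (Suc d)
  have *: "of_nat (Suc d) * diff_by F G = (\<Sum>k\<in>UNIV. diff_by (partial k F) (partial k G))"
    if "F \<in> forms (Suc d)" "G \<in> forms (Suc d)" for F G :: "'k poly4"
  proof -
    have "of_nat (Suc d) * diff_by F G = diff_by (\<Sum>k\<in>UNIV. var k * partial k F) G"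
      using diff_by_cst_mult_left[of "of_nat (Suc d)" F G] euler_forms[OF that(1)] by (simp only: cst_of_nat)
    also have "\<dots> = (\<Sum>k\<in>UNIV. diff_by (partial k F) (partial k G))"
      unfolding diff_by_sum_left diff_by_times_var
      \<comment> \<open>The other term of the commutation rule vanishes because \<open>G\<close> has
        larger degree than \<open>partial k F\<close>.\<close>
      using that by (intro sum.cong) (auto simp: diff_by_forms_0[of _ d _ "Suc d"] forms_partial)
    finally show ?thesis .
  qed
  have "of_nat (Suc d) * diff_by F G = of_nat (Suc d) * diff_by G F"
    unfolding *[OF Suc.prems] *[OF Suc.prems(2,1)]
    by (intro sum.cong refl Suc.IH forms_partial Suc.prems)
  then have "of_nat (Suc d) * (diff_by F G - diff_by G F) = 0" by (simp only: right_diff_distrib diff_self)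
  then show ?case by (simp only: of_nat_mult_eq_0_iff) auto
qed

text \<open>Testing with operators \<open>var i * G\<close> shows that every partial derivative of
  \<open>F\<close> satisfies the hypothesis one degree lower. In positive degree, Euler's identity
  then recovers \<open>F\<close> from its vanishing derivatives.\<close>

lemma diff_by_nondegenerate:
  fixes F :: "'k::field_char_0 poly4"
  assumes "F \<in> forms d" "\<And>G. G \<in> forms d \<Longrightarrow> diff_by F G = 0" shows "F = 0"
  using assms
proof (induction d arbitrary: F)
  case 0
  then show ?case using forms_cst[of 1] by fastforce
next
  case (Suc d)
  have "partial i F = 0" for i
    by (rule Suc.IH) (use Suc.prems in \<open>auto simp: forms_partial diff_by_partial forms_var_mult simp flip: diff_by_var_mult\<close>)
  then show ?case using Suc.prems(1) forms_eqI_partial by blast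
qed

section \<open>Harmonic forms of a pair of dual quadrics\<close>

lemma ideal_gen_superset: "S \<subseteq> ideal_gen S"
  unfolding ideal_gen_def by (rule Modules.module.span_superset[OF module_mult])

lemma ideal_gen_0 [simp]: "0 \<in> ideal_gen S"
  unfolding ideal_gen_def by (rule Modules.module.span_zero[OF module_mult])

lemma ideal_gen_add: "x \<in> ideal_gen S \<Longrightarrow> y \<in> ideal_gen S \<Longrightarrow> x + y \<in> ideal_gen S"
  unfolding ideal_gen_def by (rule Modules.module.span_add[OF module_mult])

lemma ideal_gen_mult: "x \<in> ideal_gen S \<Longrightarrow> r * x \<in> ideal_gen S"
  unfolding ideal_gen_def by (rule Modules.module.span_scale[OF module_mult])

lemma ideal_gen_sum: "(\<And>x. x \<in> T \<Longrightarrow> g x \<in> ideal_gen S) \<Longrightarrow> sum g T \<in> ideal_gen S"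
  unfolding ideal_gen_def by (rule Modules.module.span_sum[OF module_mult])

lemma is_ideal_ideal_gen: "is_ideal (ideal_gen S)"
  unfolding ideal_gen_def is_ideal_def by (rule Modules.module.subspace_span[OF module_mult])

lemma ideal_gen_minimal: "S \<subseteq> I \<Longrightarrow> is_ideal I \<Longrightarrow> ideal_gen S \<subseteq> I"
  unfolding ideal_gen_def is_ideal_def by (rule Modules.module.span_minimal[OF module_mult])

lemma ideal_gen_subsetI: "S \<subseteq> ideal_gen T \<Longrightarrow> ideal_gen S \<subseteq> ideal_gen T"
  by (rule ideal_gen_minimal[OF _ is_ideal_ideal_gen])

lemma is_ideal_iff: "is_ideal I \<longleftrightarrow> 0 \<in> I \<and> (\<forall>x\<in>I. \<forall>y\<in>I. x + y \<in> I) \<and> (\<forall>x\<in>I. \<forall>r. r * x \<in> I)"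
  unfolding is_ideal_def Modules.module.subspace_def[OF module_mult] by blast

lemma ideal_gen_mult_image:
  assumes "x \<in> ideal_gen S" "\<And>s. s \<in> S \<Longrightarrow> a * s \<in> ideal_gen T"
  shows "a * x \<in> ideal_gen T"
proof -
  have "a * (r * y) \<in> ideal_gen T" if "a * y \<in> ideal_gen T" for r y
    using ideal_gen_mult[OF that, of r] by (simp only: mult.left_commute)
  then have "is_ideal {x. a * x \<in> ideal_gen T}"
    unfolding is_ideal_iff by (auto simp: distrib_left ideal_gen_add)
  from ideal_gen_minimal[OF _ this, of S] assms show ?thesis by blast
qed

lemma is_ideal_annihilator: "is_ideal {G. diff_by F G = 0}"
  unfolding is_ideal_iff by (auto simp: diff_by_add_right diff_by_mult)

lemma hcomp_diff_by:
  assumes "F \<in> forms (d + e)"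
  shows "hcomp e (diff_by F G) = diff_by F (hcomp d G)"
proof (induction G rule: poly4_single_induct)
  case (single m c)
  consider "expo_degree m = d" | "expo_degree m \<noteq> d" "expo_degree m \<le> d + e" | "expo_degree m > d + e"
    by linarith
  then show ?case
  proof cases
    case 1
    then have "diff_by F (Poly_Mapping.single m c) \<in> forms e"
      using assms diff_by_forms[of F d e] forms_single by blast
    with 1 show ?thesis by (simp add: hcomp_forms[OF forms_single] hcomp_forms)
  next
    case 2
    then have "diff_by F (Poly_Mapping.single m c) \<in> forms (d + e - expo_degree m)"
      using assms by (intro diff_by_forms[OF _ forms_single]) auto
    with 2 show ?thesis by (auto simp: hcomp_forms[OF forms_single] hcomp_forms)
  next
    case 3
    then show ?thesis using diff_by_forms_0[OF assms forms_single] by (simp add: hcomp_forms[OF forms_single])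
  qed
qed (simp add: hcomp_add diff_by_add_right)

text \<open>Operators of different degrees send the form \<open>F\<close> to different degrees, so
  every homogeneous component of an annihilating polynomial annihilates \<open>F\<close>. The
  homogeneous generators of \<open>perp\<close> therefore lose nothing.\<close>

lemma perp_eq_annihilator:
  assumes F: "F \<in> forms D"
  shows "perp F = {G. diff_by F G = 0}"
proof
  show "perp F \<subseteq> {G. diff_by F G = 0}"
    unfolding perp_def by (rule ideal_gen_minimal[OF _ is_ideal_annihilator]) auto
  show "{G. diff_by F G = 0} \<subseteq> perp F"
  proof clarify
    fix G assume G: "diff_by F G = 0"
    have "diff_by F (hcomp d G) = 0" for d
    proof (cases "d \<le> D")
      case True
      then show ?thesis using hcomp_diff_by[of F d "D - d" G] F G by simp
    qed (use diff_by_forms_0[OF F hcomp_in_forms] in auto)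
    then have "hcomp d G \<in> perp F" for d
      unfolding perp_def by (intro subsetD[OF ideal_gen_superset]) (auto intro: hcomp_in_forms)
    then have "(\<Sum>d<n. hcomp d G) \<in> perp F" for n
      unfolding perp_def by (intro ideal_gen_sum)
    then show "G \<in> perp F" by (metis hcomp_decompose order_refl)
  qed
qed

section \<open>Quadratic forms as multipliers and as operators\<close>

definition quad :: "(4 \<Rightarrow> 4 \<Rightarrow> 'k) \<Rightarrow> 'k::comm_ring_1 poly4" where
  "quad A = (\<Sum>i\<in>UNIV. \<Sum>j\<in>UNIV. cst (A i j) * (var i * var j))"

lemma quad_forms: "quad A \<in> forms 2"
  unfolding quad_def using forms_mult[OF forms_var forms_var]
  by (intro forms_sum forms_cst_mult) (simp add: numeral_2_eq_2)

lemma diff_by_quad: "diff_by F (quad A) = (\<Sum>i\<in>UNIV. \<Sum>j\<in>UNIV. cst (A i j) * partial i (partial j F))"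
  by (simp add: quad_def diff_by_sum_right diff_by_cst_mult_right diff_by_var_mult)

lemma sum_delta_var: "(\<Sum>i\<in>UNIV. if k = i then f i else 0) = (f k :: 'b::comm_monoid_add)" for k :: 4
  by simp

lemma partial_quad:
  assumes "\<And>i j. A i j = A j i"
  shows "partial k (quad A) = 2 * (\<Sum>j\<in>UNIV. cst (A k j) * var j)"
proof -
  have "partial k (quad A) = (\<Sum>i\<in>UNIV. \<Sum>j\<in>UNIV. (if k = i then cst (A i j) * var j else 0) + (if k = j then cst (A i j) * var i else 0))"
    unfolding quad_def partial_sum
    by (intro sum.cong refl) (auto simp: partial_cst_mult partial_var_mult partial_var algebra_simps)
  also have "\<dots> = (\<Sum>i\<in>UNIV. if k = i then \<Sum>j\<in>UNIV. cst (A i j) * var j else 0) + (\<Sum>i\<in>UNIV. cst (A i k) * var i)"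
    unfolding sum.distrib by (intro arg_cong2[of _ _ _ _ "(+)"] sum.cong refl) auto
  also have "(\<Sum>i\<in>UNIV. cst (A i k) * var i) = (\<Sum>i\<in>UNIV. cst (A k i) * var i)"
    using assms by metis
  finally show ?thesis unfolding sum_delta_var by simp
qed

text \<open>The relation \<open>diff_by_times_var\<close> is used twice; the symmetry of
  \<open>A\<close> merges the two first-order sums, and the second-order sum is the operator
  \<open>quad A\<close> applied to \<open>G\<close>.\<close>

lemma diff_by_quad_mult:
  assumes "\<And>i j. A i j = A j i"
  shows "diff_by (quad A * F) G = quad A * diff_by F G
    + 2 * (\<Sum>i\<in>UNIV. \<Sum>j\<in>UNIV. cst (A i j) * (var i * diff_by F (partial j G))) + diff_by F (diff_by G (quad A))"
proof -
  have "diff_by (quad A * F) G = (\<Sum>i\<in>UNIV. \<Sum>j\<in>UNIV. cst (A i j) * diff_by (var i * (var j * F)) G)"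
    by (simp add: quad_def sum_distrib_right mult.assoc diff_by_sum_left diff_by_cst_mult_left)
  also have "\<dots> = (\<Sum>i\<in>UNIV. \<Sum>j\<in>UNIV. cst (A i j) * (var i * var j) * diff_by F G
      + cst (A i j) * (var i * diff_by F (partial j G)) + cst (A i j) * (var j * diff_by F (partial i G))
      + cst (A i j) * diff_by F (partial i (partial j G)))"
    unfolding diff_by_times_var
    by (intro sum.cong refl) (simp add: algebra_simps partial_commute)
  also have "\<dots> = quad A * diff_by F G
    + ((\<Sum>i\<in>UNIV. \<Sum>j\<in>UNIV. cst (A i j) * (var i * diff_by F (partial j G)))
     + (\<Sum>i\<in>UNIV. \<Sum>j\<in>UNIV. cst (A i j) * (var j * diff_by F (partial i G)))) + diff_by F (diff_by G (quad A))"
  proof -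
    have "quad A * diff_by F G = (\<Sum>i\<in>UNIV. \<Sum>j\<in>UNIV. cst (A i j) * (var i * var j) * diff_by F G)"
      by (simp add: quad_def sum_distrib_right)
    moreover have "diff_by F (diff_by G (quad A)) = (\<Sum>i\<in>UNIV. \<Sum>j\<in>UNIV. cst (A i j) * diff_by F (partial i (partial j G)))"
      by (simp add: diff_by_quad diff_by_sum_right diff_by_cst_mult_right)
    ultimately show ?thesis by (simp only: sum.distrib add.assoc)
  qed
  also have "(\<Sum>i\<in>UNIV. \<Sum>j\<in>UNIV. cst (A i j) * (var j * diff_by F (partial i G)))
     = (\<Sum>i\<in>UNIV. \<Sum>j\<in>UNIV. cst (A i j) * (var i * diff_by F (partial j G)))"
    by (subst sum.swap) (simp add: assms)
  finally show ?thesis by simp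
qed

definition harm :: "(4 \<Rightarrow> 4 \<Rightarrow> 'k::comm_ring_1) \<Rightarrow> nat \<Rightarrow> 'k poly4 set" where
  "harm A d = {h \<in> forms d. diff_by h (quad A) = 0}"

lemma harm_forms: "h \<in> harm A d \<Longrightarrow> h \<in> forms d"
  and harm_diff_by: "h \<in> harm A d \<Longrightarrow> diff_by h (quad A) = 0"
  by (simp_all add: harm_def)

lemma harm_partial: "h \<in> harm A (Suc d) \<Longrightarrow> partial i h \<in> harm A d"
  by (simp add: harm_def forms_partial diff_by_partial)

lemma harm_small: "F \<in> forms d \<Longrightarrow> d < 2 \<Longrightarrow> F \<in> harm A d"
  by (simp add: harm_def diff_by_forms_0[OF _ quad_forms])

text \<open>The assumptions say that \<open>A\<close> and \<open>B\<close> are symmetric and inverse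
  to each other. The sublocale below supplies every fact with the roles of the matrices exchanged,
  under the prefix \<open>swap\<close>. The operator of \<open>quad A\<close> is called the
  Laplacian in what follows.\<close>

locale dual_quadrics =
  fixes A B :: "4 \<Rightarrow> 4 \<Rightarrow> 'k::field_char_0"
  assumes A_sym: "A i j = A j i" and B_sym: "B i j = B j i"
    and A_B: "(\<Sum>j\<in>UNIV. A i j * B j k) = (if i = k then 1 else 0)"
begin

lemma B_A: "(\<Sum>j\<in>UNIV. B i j * A j k) = (if i = k then 1 else 0)"
  using A_B[of k i] by (simp add: A_sym[of k] B_sym[of i] mult.commute eq_commute)

lemma sum_B_A: "(\<Sum>i\<in>UNIV. \<Sum>j\<in>UNIV. \<Sum>k\<in>UNIV. cst (B i j) * (cst (A j k) * f i k)) = (\<Sum>i\<in>UNIV. f i i)"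
proof -
  have "(\<Sum>j\<in>UNIV. \<Sum>k\<in>UNIV. cst (B i j) * (cst (A j k) * f i k)) = f i i" for i
  proof -
    have "(\<Sum>j\<in>UNIV. \<Sum>k\<in>UNIV. cst (B i j) * (cst (A j k) * f i k)) = (\<Sum>k\<in>UNIV. cst (\<Sum>j\<in>UNIV. B i j * A j k) * f i k)"
      by (subst sum.swap) (simp add: cst_sum cst_mult sum_distrib_right mult.assoc)
    also have "\<dots> = (\<Sum>k\<in>UNIV. if i = k then f i k else 0)"
      unfolding B_A by (intro sum.cong) auto
    finally show ?thesis by simp
  qed
  then show ?thesis by simp
qed

text \<open>The constant is twice the trace of the 4 by 4 identity matrix.\<close>

lemma diff_by_quad_quad: "diff_by (quad A) (quad B) = cst 8"
proof -
  have "diff_by (quad A) (quad B) = (\<Sum>i\<in>UNIV. \<Sum>j\<in>UNIV. \<Sum>k\<in>UNIV. cst (B i j) * (cst (A j k) * (if i = k then 2 else 0)))"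
    unfolding diff_by_quad partial_quad[OF A_sym]
    by (intro sum.cong refl)
      (simp add: partial_mult partial_sum partial_cst_mult partial_var sum_distrib_left if_distrib partial_cst[of _ 2, unfolded cst_numeral] cong: if_cong)
  also have "\<dots> = cst 8"
    unfolding sum_B_A by (simp add: cst_numeral)
  finally show ?thesis .
qed

text \<open>An \<open>sl_2\<close> relation: in the first-order part of
  \<open>diff_by_quad_mult\<close> the two matrices contract to the identity and leave the Euler
  operator, while the second-order part is the constant from
  \<open>diff_by_quad_quad\<close>.\<close>

lemma diff_by_quad_mult_dual:
  "diff_by (quad B * F) (quad A) = quad B * diff_by F (quad A) + 4 * euler F + 8 * F"
proof -
  have "(\<Sum>i\<in>UNIV. \<Sum>j\<in>UNIV. cst (B i j) * (var i * diff_by F (partial j (quad A))))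
    = (\<Sum>i\<in>UNIV. \<Sum>j\<in>UNIV. \<Sum>k\<in>UNIV. cst (B i j) * (cst (A j k) * (2 * var i * partial k F)))"
    unfolding partial_quad[OF A_sym]
    by (intro sum.cong refl)
      (simp add: diff_by_numeral_mult_right diff_by_sum_right diff_by_cst_mult_right sum_distrib_left, simp add: ac_simps)
  also have "\<dots> = 2 * euler F"
    unfolding sum_B_A euler_def by (simp add: sum_distrib_left ac_simps)
  finally show ?thesis
    by (simp add: diff_by_quad_mult[OF B_sym] diff_by_quad_quad cst_numeral)
qed

end

sublocale dual_quadrics \<subseteq> swap: dual_quadrics B A
  by unfold_locales (rule B_sym A_sym B_A)+

context dual_quadrics
begin

lemma diff_by_quad_mult_forms:
  assumes "F \<in> forms d"
  shows "diff_by (quad B * F) (quad A) = quad B * diff_by F (quad A) + of_nat (4 * d + 8) * F"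
  using assms unfolding diff_by_quad_mult_dual forms_iff_euler by (simp add: algebra_simps)

text \<open>The operators \<open>quad B * diff_by _ (quad A) + c\<close> with \<open>c > 0\<close> are bijective on every graded
  piece, because they are intertwined by \<open>diff_by _ (quad A)\<close> with an operator of the same shape
  in degree lower by two.\<close>

lemma shifted_laplacian_surj:
  assumes "G \<in> forms e" "c > 0"
  shows "\<exists>g\<in>forms e. quad B * diff_by g (quad A) + of_nat c * g = G"
  using assms
proof (induction e arbitrary: G c rule: less_induct)
  case (less e)
  have c: "of_nat c * (cst (inverse (of_nat c)) * F) = F" for F :: "'k poly4"
    using of_nat_inverse_mult[of c F] less.prems(2) by simp
  show ?case
  proof (cases "e < 2")
    case True
    then have "diff_by G (quad A) = 0"
      using less.prems by (simp add: diff_by_forms_0[OF _ quad_forms])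
    then show ?thesis
      using less.prems c[of G] by (intro bexI[of _ "cst (inverse (of_nat c)) * G"])
        (simp_all add: diff_by_cst_mult_left forms_cst_mult)
  next
    case False
    then obtain d where d: "e = d + 2" by (metis add.commute le_Suc_ex not_less)
    have "diff_by G (quad A) \<in> forms d"
      using less.prems d by (intro diff_by_forms[OF _ quad_forms]) (simp add: add.commute)
    then obtain u where u: "u \<in> forms d"
        "quad B * diff_by u (quad A) + of_nat (c + (4 * d + 8)) * u = diff_by G (quad A)"
      using less.IH[of d "diff_by G (quad A)" "c + (4 * d + 8)"] d by auto
    \<comment> \<open>If \<open>u\<close> is to be the Laplacian of \<open>g\<close>, the equation
      \<open>quad B * u + of_nat c * g = G\<close> determines \<open>g\<close>. The equation
      satisfied by \<open>u\<close> then guarantees that \<open>u\<close> really is the Laplacian of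
      this \<open>g\<close>.\<close>
    let ?g = "cst (inverse (of_nat c)) * (G - quad B * u)"
    have "quad B * u \<in> forms e" using forms_mult[OF quad_forms u(1), of B] d by (simp add: add.commute)
    then have "?g \<in> forms e" using less.prems by (intro forms_cst_mult forms_diff)
    moreover have "diff_by (G - quad B * u) (quad A) = of_nat c * u"
      unfolding diff_by_diff_left diff_by_quad_mult_forms[OF u(1)] u(2)[symmetric] by (simp add: algebra_simps)
    then have "diff_by ?g (quad A) = u"
      using c[of u] by (simp add: diff_by_cst_mult_left mult.left_commute)
    moreover have "quad B * u + of_nat c * ?g = G"
      unfolding c by simp
    ultimately show ?thesis by (intro bexI[of _ ?g]) simp_all
  qed
qed

lemma shifted_laplacian_inj:
  assumes "g \<in> forms e" "c > 0" "quad B * diff_by g (quad A) + of_nat c * g = 0"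
  shows "g = 0"
  using assms
proof (induction e arbitrary: g c rule: less_induct)
  case (less e)
  have "diff_by g (quad A) = 0"
  proof (cases "e < 2")
    case True
    then show ?thesis using less.prems by (simp add: diff_by_forms_0[OF _ quad_forms])
  next
    case False
    then obtain d where d: "e = d + 2" by (metis add.commute le_Suc_ex not_less)
    define u where "u = diff_by g (quad A)"
    have u: "u \<in> forms d"
      unfolding u_def using less.prems d by (intro diff_by_forms[OF _ quad_forms]) (simp add: add.commute)
    have "0 = diff_by (quad B * u + cst (of_nat c) * g) (quad A)"
      using less.prems(3) by (simp add: u_def cst_of_nat)
    also have "\<dots> = quad B * diff_by u (quad A) + of_nat (c + (4 * d + 8)) * u"
      unfolding diff_by_add_left diff_by_quad_mult_forms[OF u] diff_by_cst_mult_left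
      by (simp add: cst_of_nat algebra_simps flip: u_def)
    finally show ?thesis
      using less.IH[of d u "c + (4 * d + 8)"] u d by (simp add: u_def)
  qed
  then show ?case using less.prems by (simp add: of_nat_mult_eq_0_iff)
qed

text \<open>This makes the decomposition below direct. The commutation rule rewrites the hypothesis
  as the vanishing of the shifted operator with \<open>c = 4 * d + 8\<close>, which is
  injective.\<close>

lemma diff_by_quad_mult_eq_0:
  assumes "u \<in> forms d" "diff_by (quad B * u) (quad A) = 0"
  shows "u = 0"
  using assms shifted_laplacian_inj[of u d "4 * d + 8"] by (simp add: diff_by_quad_mult_forms)

text \<open>The cofactor \<open>u\<close> must satisfy that \<open>quad B * u\<close> and
  \<open>F\<close> have the same Laplacian; by the commutation rule this is a shifted equation,
  solvable by \<open>shifted_laplacian_surj\<close>. The clause for \<open>e < 2\<close> excludes a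
  spurious constant \<open>u\<close> when \<open>e - 2\<close> is truncated.\<close>

lemma harm_decompose:
  assumes "F \<in> forms e"
  obtains h u where "h \<in> harm A e" "u \<in> forms (e - 2)" "e < 2 \<longrightarrow> u = 0" "F = h + quad B * u"
proof (cases "e < 2")
  case True
  then show ?thesis using that[of F 0] assms by (simp add: harm_small)
next
  case False
  then obtain d where d: "e = d + 2" by (metis add.commute le_Suc_ex not_less)
  have "diff_by F (quad A) \<in> forms d"
    using assms d by (intro diff_by_forms[OF _ quad_forms]) (simp add: add.commute)
  then obtain u where u: "u \<in> forms d" "quad B * diff_by u (quad A) + of_nat (4 * d + 8) * u = diff_by F (quad A)"
    using shifted_laplacian_surj[of "diff_by F (quad A)" d "4 * d + 8"] by auto
  have "quad B * u \<in> forms e" using forms_mult[OF quad_forms u(1), of B] d by (simp add: add.commute)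
  then have "F - quad B * u \<in> harm A e"
    using assms u by (simp add: harm_def forms_diff diff_by_diff_left diff_by_quad_mult_forms)
  then show ?thesis using that[of "F - quad B * u" u] u d by simp
qed

text \<open>Each \<open>var j * h\<close> is made harmonic by subtracting a multiple of
  \<open>quad B * D j\<close>. Contracting the corrected forms \<open>h' j\<close> with
  \<open>B\<close> and the variables gives back a nonzero multiple of \<open>quad B * h\<close>, by
  Euler's identity.\<close>

lemma quad_mult_harm:
  assumes h: "h \<in> harm A d"
  shows "quad B * h \<in> ideal_gen (harm A (Suc d))"
proof -
  define D where "D j = (\<Sum>k\<in>UNIV. cst (A j k) * partial k h)" for j
  \<comment> \<open>The Laplacian of \<open>var j * h\<close> is \<open>2 * D j\<close>, and that of
    \<open>quad B * D j\<close> is \<open>4 * d + 4\<close> times \<open>D j\<close>;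
    \<open>c\<close> is the ratio of these factors.\<close>
  define c where "c = inverse (of_nat (2 * d + 2) :: 'k)"
  define h' where "h' j = var j * h - cst c * (quad B * D j)" for j
  have c: "of_nat (2 * d + 2) * (cst c * F) = F" for F :: "'k poly4"
    unfolding c_def by (rule of_nat_inverse_mult) simp
  have D: "D j \<in> forms (d - 1)" "diff_by (D j) (quad A) = 0" for j
    unfolding D_def by (intro forms_sum forms_cst_mult forms_partial_diff harm_forms[OF h])
      (simp add: diff_by_sum_left diff_by_cst_mult_left diff_by_partial harm_diff_by[OF h])
  \<comment> \<open>For \<open>d = 0\<close> the truncated degree \<open>d - 1\<close> would give
    wrong counts; the vanishing of \<open>D j\<close> keeps the formulas valid.\<close>
  have D0: "D j = 0" if "d = 0" for j
    unfolding D_def using harm_forms[OF h] that by (simp add: forms_0_partial)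
  have lapD: "diff_by (quad B * D j) (quad A) = of_nat (4 * d + 4) * D j" for j
    unfolding diff_by_quad_mult_forms[OF D(1)] D(2) using D0[of j] by (cases d) (auto simp: algebra_simps)
  have "diff_by (var j * h) (quad A) = 2 * D j" for j
    unfolding diff_by_times_var harm_diff_by[OF h] partial_quad[OF A_sym] D_def
    by (simp add: diff_by_numeral_mult_right diff_by_sum_right diff_by_cst_mult_right)
  then have "diff_by (h' j) (quad A) = 2 * D j - of_nat 2 * (of_nat (2 * d + 2) * (cst c * D j))" for j
    unfolding h'_def diff_by_diff_left diff_by_cst_mult_left lapD by (simp add: algebra_simps)
  then have "diff_by (h' j) (quad A) = 0" for j
    unfolding c by simp
  moreover have "h' j \<in> forms (Suc d)" for j
  proof -
    have "quad B * D j \<in> forms (Suc d)"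
      using forms_mult[OF quad_forms[of B] D(1)[of j]] D0[of j] by (cases d) simp_all
    then show ?thesis unfolding h'_def
      by (intro forms_diff forms_cst_mult forms_var_mult harm_forms[OF h])
  qed
  ultimately have h': "h' j \<in> harm A (Suc d)" for j
    by (simp add: harm_def)
  have BD: "(\<Sum>i\<in>UNIV. \<Sum>j\<in>UNIV. cst (B i j) * (var i * D j)) = of_nat d * h"
  proof -
    have "(\<Sum>i\<in>UNIV. \<Sum>j\<in>UNIV. cst (B i j) * (var i * D j))
      = (\<Sum>i\<in>UNIV. \<Sum>j\<in>UNIV. \<Sum>k\<in>UNIV. cst (B i j) * (cst (A j k) * (var i * partial k h)))"
      unfolding D_def by (simp add: sum_distrib_left ac_simps)
    then show ?thesis unfolding sum_B_A euler_forms[OF harm_forms[OF h]] .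
  qed
  have "(\<Sum>i\<in>UNIV. \<Sum>j\<in>UNIV. cst (B i j) * (var i * h' j))
    = quad B * h - cst c * (quad B * (\<Sum>i\<in>UNIV. \<Sum>j\<in>UNIV. cst (B i j) * (var i * D j)))"
  proof -
    have "(\<Sum>i\<in>UNIV. \<Sum>j\<in>UNIV. cst (B i j) * (var i * h' j))
      = (\<Sum>i\<in>UNIV. \<Sum>j\<in>UNIV. cst (B i j) * (var i * var j) * h - cst c * (quad B * (cst (B i j) * (var i * D j))))"
      unfolding h'_def by (simp add: algebra_simps)
    then show ?thesis
      by (simp only: sum_subtractf sum_distrib_left[symmetric] sum_distrib_right[symmetric] quad_def[of B, symmetric])
  qed
  note eq0 = this[unfolded BD]
  \<comment> \<open>The contraction equals \<open>quad B * h\<close> times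
    \<open>1 - d / (2 * d + 2)\<close>. Clearing the denominator leaves the factor
    \<open>d + 2\<close>, which is invertible.\<close>
  have "of_nat (2 * d + 2) * (\<Sum>i\<in>UNIV. \<Sum>j\<in>UNIV. cst (B i j) * (var i * h' j))
    = of_nat (2 * d + 2) * (quad B * h) - quad B * (of_nat d * h)"
    unfolding eq0 right_diff_distrib c ..
  also have "\<dots> = of_nat (d + 2) * (quad B * h)"
    by (simp add: algebra_simps)
  finally have eq: "of_nat (d + 2) * (quad B * h) = of_nat (2 * d + 2) * (\<Sum>i\<in>UNIV. \<Sum>j\<in>UNIV. cst (B i j) * (var i * h' j))" ..
  have "(\<Sum>i\<in>UNIV. \<Sum>j\<in>UNIV. cst (B i j) * (var i * h' j)) \<in> ideal_gen (harm A (Suc d))"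
    using h' ideal_gen_superset by (intro ideal_gen_sum ideal_gen_mult) blast
  then have "cst (inverse (of_nat (d + 2))) * (of_nat (d + 2) * (quad B * h)) \<in> ideal_gen (harm A (Suc d))"
    unfolding eq by (intro ideal_gen_mult)
  then show ?thesis
    using of_nat_inverse_mult[of "d + 2" "quad B * h"] by (simp only: mult.left_commute)
qed

lemma quad_power_mult_harm:
  assumes h: "h \<in> harm A d"
  shows "quad B ^ n * h \<in> ideal_gen (harm A (d + n))"
proof (induction n)
  case 0
  then show ?case using h ideal_gen_superset by auto
next
  case (Suc n)
  have "quad B * (quad B ^ n * h) \<in> ideal_gen (harm A (Suc (d + n)))"
    by (rule ideal_gen_mult_image[OF Suc quad_mult_harm])
  then show ?case by (simp add: mult.assoc)
qed

text \<open>In \<open>diff_by_quad_mult\<close> for \<open>quad A * quad A ^ t\<close> the last term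
  vanishes because \<open>h\<close> is harmonic. The others apply \<open>h\<close> or its partial
  derivatives to \<open>quad A ^ t\<close>; all of these are harmonic of degree above
  \<open>t\<close>, so induction applies.\<close>

lemma harm_annihilates_power:
  assumes "h \<in> harm A d" "t < d"
  shows "diff_by (quad A ^ t) h = 0"
  using assms
proof (induction t arbitrary: d h)
  case 0
  then show ?case using diff_by_forms_0[OF forms_cst[of 1] harm_forms] by force
next
  case (Suc t)
  then obtain e where d: "d = Suc e" by (cases d) auto
  have "diff_by (quad A ^ t) (partial j h) = 0" for j
    using Suc.prems d by (intro Suc.IH[of _ e] harm_partial) auto
  then show ?case using Suc by (simp add: diff_by_quad_mult[OF A_sym] harm_diff_by)
qed

lemma quad_power_forms: "quad A ^ t \<in> forms (2 * t)"
  using forms_power[OF quad_forms] by (simp add: mult.commute)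

end

section \<open>Derivatives of powers of the quadric and their annihilator\<close>

context dual_quadrics
begin

text \<open>Each step of the commutation rule adds \<open>8 * s + 16\<close>, the difference of
  consecutive values of \<open>4 * (s + 1) * (s + 2)\<close>.\<close>

lemma diff_by_power_dual: "diff_by (quad A ^ Suc s) (quad B) = of_nat (4 * (s + 1) * (s + 2)) * quad A ^ s"
proof (induction s)
  case 0
  then show ?case by (simp add: diff_by_quad_quad cst_numeral)
next
  case (Suc s)
  have "diff_by (quad A ^ Suc (Suc s)) (quad B)
    = quad A * (of_nat (4 * (s + 1) * (s + 2)) * quad A ^ s) + of_nat (4 * (2 * Suc s) + 8) * quad A ^ Suc s"
    using swap.diff_by_quad_mult_forms[OF quad_power_forms[of "Suc s"]] Suc.IH by simp
  then show ?case by (simp add: algebra_simps)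
qed

text \<open>Only \<open>c\<close> being nonzero matters: it is a product of factors from
  \<open>diff_by_power_dual\<close>, all nonzero in characteristic zero.\<close>

lemma diff_by_power_power_dual: "\<exists>c. c \<noteq> 0 \<and> diff_by (quad A ^ (n + s)) (quad B ^ n) = cst c * quad A ^ s"
proof (induction n)
  case 0
  show ?case by (intro exI[of _ 1]) simp
next
  case (Suc n)
  then obtain c where c: "c \<noteq> 0" "diff_by (quad A ^ (n + s)) (quad B ^ n) = cst c * quad A ^ s" by blast
  let ?a = "of_nat (4 * (n + s + 1) * (n + s + 2)) :: 'k"
  have "diff_by (quad A ^ (Suc n + s)) (quad B ^ Suc n) = diff_by (diff_by (quad A ^ Suc (n + s)) (quad B)) (quad B ^ n)"
    by (simp only: power_Suc diff_by_mult_commute add_Suc)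
  also have "\<dots> = diff_by (cst ?a * quad A ^ (n + s)) (quad B ^ n)"
    by (simp only: diff_by_power_dual cst_of_nat)
  also have "\<dots> = cst (?a * c) * quad A ^ s"
    by (simp only: diff_by_cst_mult_left c(2) cst_mult mult.assoc)
  finally show ?case using c(1) by (intro exI[of _ "?a * c"]) (auto simp del: of_nat_mult of_nat_add)
qed

text \<open>The extra power of \<open>quad A\<close> makes the induction on \<open>e\<close> work.
  In degree 0 powers of \<open>quad B\<close> produce the powers of \<open>quad A\<close>. In the
  step, the product rule for \<open>G * quad A ^ Suc s\<close> isolates the combinations of
  \<open>var k * G * quad A ^ s\<close> with coefficients from a row of \<open>A\<close>, and
  multiplication by \<open>B\<close> separates them.\<close>

lemma range_diff_by_power:
  assumes "F \<in> forms e" "e + s \<le> t"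
  shows "F * quad A ^ s \<in> range (diff_by (quad A ^ t))"
  using assms
proof (induction e arbitrary: F s rule: less_induct)
  case (less e)
  let ?M = "range (diff_by (quad A ^ t))"
  have M_0: "0 \<in> ?M"
    by (metis diff_by_0(1) rangeI)
  have M_add: "x + y \<in> ?M" if "x \<in> ?M" "y \<in> ?M" for x y
    using that by (auto simp flip: diff_by_add_right)
  have M_diff: "x - y \<in> ?M" if "x \<in> ?M" "y \<in> ?M" for x y
    using that by (auto simp flip: diff_by_diff_right)
  have M_cst: "cst c * x \<in> ?M" if "x \<in> ?M" for x c
    using that by (auto simp flip: diff_by_cst_mult_right)
  have M_partial: "partial i x \<in> ?M" if "x \<in> ?M" for x i
    using that by (auto simp flip: diff_by_var_mult)
  have M_sum: "sum f UNIV \<in> ?M" if "\<And>i. f i \<in> ?M" for f :: "4 \<Rightarrow> 'k poly4"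
    using that M_add by (simp add: sum_4)
  have M_of_nat: "x \<in> ?M" if "of_nat n * x \<in> ?M" "n \<noteq> 0" for n x
    using M_cst[OF that(1), of "inverse (of_nat n)"] of_nat_inverse_mult[OF that(2), of x]
    by (simp only: mult.left_commute)
  show ?case
  proof (cases e)
    case 0
    then obtain c where F: "F = cst c" using less.prems by (auto elim: forms_0_cst)
    obtain n where n: "t = n + s" using less.prems(2) by (metis add.commute add_leE le_Suc_ex)
    obtain b where b: "b \<noteq> 0" "diff_by (quad A ^ t) (quad B ^ n) = cst b * quad A ^ s"
      using diff_by_power_power_dual n by blast
    have "cst (c * inverse b) * (cst b * quad A ^ s) \<in> ?M"
      by (rule M_cst) (auto simp flip: b(2))
    moreover have "cst (c * inverse b) * cst b = cst c"
      unfolding cst_mult[symmetric] using b(1) by (simp add: mult.assoc)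
    ultimately show ?thesis by (simp only: F mult.assoc[symmetric])
  next
    case (Suc d)
    have step: "var j * G * quad A ^ s \<in> ?M" if G: "G \<in> forms d" for j G
    proof -
      have "partial i G * quad A ^ Suc s \<in> ?M" for i
      proof (cases d)
        case 0
        then show ?thesis using G M_0 by (simp add: forms_0_partial)
      next
        case (Suc d')
        then show ?thesis using G less.prems \<open>e = Suc d\<close> by (intro less.IH[of d'] forms_partial) auto
      qed
      moreover have "partial i (G * quad A ^ Suc s) \<in> ?M" for i
        using G less.prems Suc by (intro M_partial less.IH[of d]) auto
      ultimately have "partial i (G * quad A ^ Suc s) - partial i G * quad A ^ Suc s \<in> ?M" for i
        using M_diff by blast
      moreover have "partial i (G * quad A ^ Suc s) - partial i G * quad A ^ Suc s
        = of_nat (2 * Suc s) * (\<Sum>k\<in>UNIV. cst (A i k) * (var k * G * quad A ^ s))" for i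
        unfolding partial_mult[of i G] partial_power partial_quad[OF A_sym]
        by (simp add: sum_distrib_left algebra_simps)
      ultimately have *: "(\<Sum>k\<in>UNIV. cst (A i k) * (var k * G * quad A ^ s)) \<in> ?M" for i
        using M_of_nat[of "2 * Suc s"] by simp
      have "(\<Sum>i\<in>UNIV. cst (B j i) * (\<Sum>k\<in>UNIV. cst (A i k) * (var k * G * quad A ^ s))) \<in> ?M"
        by (rule M_sum, rule M_cst, rule *)
      moreover have "(\<Sum>i\<in>UNIV. cst (B j i) * (\<Sum>k\<in>UNIV. cst (A i k) * (var k * G * quad A ^ s))) = var j * G * quad A ^ s"
      proof -
        have "(\<Sum>i\<in>UNIV. cst (B j i) * (\<Sum>k\<in>UNIV. cst (A i k) * (var k * G * quad A ^ s)))
          = (\<Sum>k\<in>UNIV. cst (\<Sum>i\<in>UNIV. B j i * A i k) * (var k * G * quad A ^ s))"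
          unfolding sum_distrib_left by (subst sum.swap) (simp add: cst_sum cst_mult sum_distrib_right mult.assoc)
        also have "\<dots> = (\<Sum>k\<in>UNIV. if j = k then var k * G * quad A ^ s else 0)"
          unfolding B_A by (intro sum.cong) auto
        finally show ?thesis by simp
      qed
      ultimately show ?thesis by simp
    qed
    have "(\<Sum>j\<in>UNIV. var j * partial j F * quad A ^ s) \<in> ?M"
      using less.prems Suc by (intro M_sum step forms_partial) auto
    then have "of_nat e * (F * quad A ^ s) \<in> ?M"
      unfolding sum_distrib_right[symmetric] euler_forms[OF less.prems(1)] by (simp only: mult.assoc)
    then show ?thesis using M_of_nat Suc by blast
  qed
qed

lemma diff_by_power_surj:
  assumes "F \<in> forms e" "e \<le> t"
  obtains P where "P \<in> forms (2 * t - e)" "F = diff_by (quad A ^ t) P"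
proof -
  obtain P where "F = diff_by (quad A ^ t) P"
    using range_diff_by_power[OF assms(1), of 0 t] assms(2) by auto
  \<comment> \<open>The preimage \<open>P\<close> need not be homogeneous, but its component of
    degree \<open>2 * t - e\<close> already maps to \<open>F\<close>.\<close>
  then have "hcomp e F = diff_by (quad A ^ t) (hcomp (2 * t - e) P)"
    using hcomp_diff_by[of "quad A ^ t" "2 * t - e" e P] quad_power_forms[of t] assms(2) by simp
  then show ?thesis using that[OF hcomp_in_forms] assms(1) by (simp add: hcomp_forms)
qed

text \<open>Any \<open>F\<close> of degree \<open>e\<close> arises from \<open>quad A ^ t\<close> by
  some operator \<open>P\<close>. Operators commute, so the pairing of \<open>F\<close> with
  \<open>G\<close> is \<open>P\<close> applied to zero, and nondegeneracy gives the claim.\<close>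

lemma diff_by_power_inj:
  assumes "G \<in> forms e" "e \<le> t" "diff_by (quad A ^ t) G = 0"
  shows "G = 0"
proof (rule diff_by_nondegenerate[OF assms(1)])
  fix F :: "'k poly4" assume F: "F \<in> forms e"
  then obtain P where "F = diff_by (quad A ^ t) P"
    using diff_by_power_surj assms(2) by blast
  then have "diff_by F G = 0"
    using assms(3) by (simp flip: diff_by_mult_commute add: diff_by_mult)
  then show "diff_by G F = 0" using diff_by_symmetric[OF F assms(1)] by simp
qed

text \<open>Induction on \<open>m\<close> through Euler's identity: reducing the partial derivatives
  leaves \<open>quad B ^ m * g'\<close> with \<open>g'\<close> of degree \<open>t - m + 1\<close>.
  The harmonic part of \<open>g'\<close> times \<open>quad B ^ m\<close> lies in the ideal because
  \<open>(t - m + 1) + m = t + 1\<close>, and the rest gains a factor \<open>quad B\<close>. The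
  clause for \<open>t < m\<close> makes up for truncated subtraction.\<close>

lemma reduce_mod_harm:
  assumes "G \<in> forms (t + m)"
  shows "\<exists>k\<in>ideal_gen (harm A (Suc t)). \<exists>g\<in>forms (t - m). (t < m \<longrightarrow> g = 0) \<and> G = k + quad B ^ m * g"
  using assms
proof (induction m arbitrary: G)
  case 0
  then show ?case by (intro bexI[of _ 0] bexI[of _ G]) auto
next
  case (Suc m)
  let ?K = "ideal_gen (harm A (Suc t))"
  have "\<forall>i. \<exists>k g. k \<in> ?K \<and> g \<in> forms (t - m) \<and> (t < m \<longrightarrow> g = 0) \<and> partial i G = k + quad B ^ m * g"
    using Suc.IH[OF forms_partial] Suc.prems by (metis add_Suc_right)
  then obtain k g where kg: "\<And>i. k i \<in> ?K" "\<And>i. g i \<in> forms (t - m)" "\<And>i. t < m \<Longrightarrow> g i = 0"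
      "\<And>i. partial i G = k i + quad B ^ m * g i" by metis
  define c where "c = inverse (of_nat (t + Suc m) :: 'k)"
  define k' where "k' = cst c * (\<Sum>i\<in>UNIV. var i * k i)"
  define g' where "g' = cst c * (\<Sum>i\<in>UNIV. var i * g i)"
  have "G = cst c * (of_nat (t + Suc m) * G)"
    using of_nat_inverse_mult[of "t + Suc m" G] unfolding c_def by (simp only: mult.left_commute)
  also have "\<dots> = k' + quad B ^ m * g'"
    unfolding euler_forms[OF Suc.prems, symmetric] kg(4) k'_def g'_def
    by (simp add: algebra_simps sum.distrib sum_distrib_left)
  finally have G: "G = k' + quad B ^ m * g'" .
  have k': "k' \<in> ?K" unfolding k'_def using kg by (intro ideal_gen_mult ideal_gen_sum)
  show ?case
  proof (cases "t < m")
    case True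
    then show ?thesis using k' kg(3) by (intro bexI[of _ k'] bexI[of _ 0]) (simp_all add: G g'_def)
  next
    case False
    have "g' \<in> forms (Suc (t - m))" unfolding g'_def
      using kg by (intro forms_cst_mult forms_sum forms_var_mult)
    then obtain h u where hu: "h \<in> harm A (Suc (t - m))" "u \<in> forms (Suc (t - m) - 2)"
        "Suc (t - m) < 2 \<longrightarrow> u = 0" "g' = h + quad B * u"
      by (rule harm_decompose)
    have "quad B ^ m * h \<in> ?K"
      using quad_power_mult_harm[OF hu(1), of m] False by simp
    then have "k' + quad B ^ m * h \<in> ?K" using k' by (rule ideal_gen_add[rotated])
    then show ?thesis using hu(2,3)
      by (intro bexI[of _ "k' + quad B ^ m * h"] bexI[of _ u]) (auto simp: G hu(4) algebra_simps)
  qed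
qed

theorem perp_power: "perp (quad A ^ t) = ideal_gen (harm A (Suc t))"
proof
  have "ideal_gen (harm A (Suc t)) \<subseteq> {G. diff_by (quad A ^ t) G = 0}"
    by (rule ideal_gen_minimal[OF _ is_ideal_annihilator]) (auto intro: harm_annihilates_power)
  note K = subsetD[OF this]
  then show "ideal_gen (harm A (Suc t)) \<subseteq> perp (quad A ^ t)"
    using perp_eq_annihilator[OF quad_power_forms] by auto
  show "perp (quad A ^ t) \<subseteq> ideal_gen (harm A (Suc t))"
    unfolding perp_def
  proof (rule ideal_gen_subsetI, safe)
    fix G :: "'k poly4" and d
    assume G: "G \<in> forms d" "diff_by (quad A ^ t) G = 0"
    show "G \<in> ideal_gen (harm A (Suc t))"
    proof (cases "d \<le> t")
      case True
      then show ?thesis using diff_by_power_inj[OF G(1) _ G(2)] by simp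
    next
      case False
      then obtain m where m: "d = t + m" by (metis le_Suc_ex nat_le_linear)
      obtain k g where kg: "k \<in> ideal_gen (harm A (Suc t))" "g \<in> forms (t - m)" "t < m \<longrightarrow> g = 0"
          "G = k + quad B ^ m * g"
        using reduce_mod_harm G(1) unfolding m by blast
      have "g = 0"
      proof (cases "t < m")
        case False
        then obtain s where s: "t = m + s" by (metis le_Suc_ex not_less)
        obtain c where c: "c \<noteq> 0" "diff_by (quad A ^ t) (quad B ^ m) = cst c * quad A ^ s"
          using diff_by_power_power_dual s by blast
        \<comment> \<open>The factor \<open>quad B ^ m\<close> lowers \<open>quad A ^ t\<close> to a
          nonzero multiple of \<open>quad A ^ s\<close> with \<open>s = t - m\<close>, and
          \<open>g\<close> has degree exactly \<open>s\<close>, so injectivity applies.\<close>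
        have "0 = diff_by (quad A ^ t) (quad B ^ m * g)"
          using G(2) K[OF kg(1)] by (simp add: kg(4) diff_by_add_right)
        also have "\<dots> = cst c * diff_by (quad A ^ s) g"
          by (simp add: diff_by_mult_commute c(2) diff_by_cst_mult_left)
        finally have "cst (inverse c) * (cst c * diff_by (quad A ^ s) g) = 0" by simp
        then have "diff_by (quad A ^ s) g = 0"
          using c(1) by (simp flip: mult.assoc cst_mult)
        then show ?thesis using diff_by_power_inj[of g s s] kg(2) s by simp
      qed (use kg in blast)
      then show ?thesis using kg by simp
    qed
  qed
qed

end

section \<open>Powers of isotropic linear forms\<close>

definition lin :: "(4 \<Rightarrow> 'k) \<Rightarrow> 'k::comm_ring_1 poly4" where
  "lin v = (\<Sum>i\<in>UNIV. cst (v i) * var i)"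

lemma lin_forms: "lin v \<in> forms 1"
  unfolding lin_def by (intro forms_sum forms_cst_mult forms_var)

lemma lookup_cst_mult_var: "Poly_Mapping.lookup (cst c * var i) (Poly_Mapping.single j 1) = (if i = j then c else 0)"
proof -
  have "cst c * var i = Poly_Mapping.single (Poly_Mapping.single i 1) c"
    by (simp add: cst_def var_def mult_single)
  moreover have "Poly_Mapping.single i (1::nat) = Poly_Mapping.single j 1 \<longleftrightarrow> i = j"
    by (metis lookup_single_eq lookup_single_not_eq zero_neq_one)
  ultimately show ?thesis by (simp add: lookup_single when_def)
qed

lemma dual_point_lin: "dual_point (lin v) = v"
  unfolding dual_point_def lin_def lookup_sum lookup_cst_mult_var by simp

lemma lin_dual_point: "l \<in> forms 1 \<Longrightarrow> lin (dual_point l) = l"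
proof -
  have "F = lin (dual_point F)" if "F \<in> forms d" "d = 1" for F :: "'a poly4" and d
    using that
  proof (induction F rule: forms_induct)
    case (var_mult d i F)
    then obtain c where F: "F = cst c" by (auto elim: forms_0_cst)
    have "lin (dual_point (cst c * var i)) = (\<Sum>j\<in>UNIV. if i = j then cst c * var j else 0)"
      unfolding lin_def dual_point_def lookup_cst_mult_var by (intro sum.cong) auto
    then show ?case by (simp add: F mult.commute)
  next
    case (add d F G)
    then show ?case
      by (simp add: lin_def dual_point_def lookup_add cst_add distrib_right sum.distrib)
  qed (auto simp: lin_def dual_point_def)
  then show "l \<in> forms 1 \<Longrightarrow> lin (dual_point l) = l" by metis
qed

lemma lin_eq_0_iff: "lin v = 0 \<longleftrightarrow> v = (\<lambda>_. 0)"
proof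
  assume "lin v = 0"
  then show "v = (\<lambda>_. 0)" using dual_point_lin[of v] by (simp add: dual_point_def)
qed (simp add: lin_def)

lemma partial_lin: "partial i (lin v) = cst (v i)"
  by (simp add: lin_def partial_sum partial_cst_mult partial_var if_distrib[of "\<lambda>x. _ * x"] cong: if_cong)

lemma diff_by_lin: "diff_by F (lin v) = (\<Sum>i\<in>UNIV. cst (v i) * partial i F)"
  by (simp add: lin_def diff_by_sum_right diff_by_cst_mult_right)

lemma diff_by_lin_mult: "diff_by (F * G) (lin v) = diff_by F (lin v) * G + F * diff_by G (lin v)"
  by (simp add: diff_by_lin partial_mult algebra_simps sum.distrib sum_distrib_left sum_distrib_right)

lemma eval4_lin: "eval4 w (lin v) = (\<Sum>i\<in>UNIV. v i * w i)"
  by (simp add: lin_def ev.ins_sum ev.ins_mult ev.ins_cst ev.ins_var)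

lemma eval4_quad: "eval4 w (quad A) = (\<Sum>i\<in>UNIV. \<Sum>j\<in>UNIV. A i j * (w i * w j))"
  by (simp add: quad_def ev.ins_sum ev.ins_mult ev.ins_cst ev.ins_var)

text \<open>Under the apolarity pairing a power of a linear form represents evaluation at its dual
  point, up to a factorial. One directional derivative along \<open>v\<close>, evaluated at
  \<open>v\<close>, is Euler's identity.\<close>

lemma diff_by_lin_power:
  fixes F :: "'k::field_char_0 poly4"
  assumes "F \<in> forms d"
  shows "diff_by F (lin v ^ d) = cst (fact d * eval4 v F)"
  using assms
proof (induction d arbitrary: F)
  case 0
  then show ?case by (auto elim!: forms_0_cst simp: ev.ins_cst)
next
  case (Suc d)
  have "diff_by F (lin v) \<in> forms d"
    using Suc.prems lin_forms by (intro diff_by_forms[of _ 1]) auto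
  then have "diff_by F (lin v ^ Suc d) = cst (fact d * eval4 v (diff_by F (lin v)))"
    by (simp add: diff_by_mult_commute Suc.IH)
  also have "eval4 v (diff_by F (lin v)) = eval4 v (\<Sum>i\<in>UNIV. var i * partial i F)"
    by (simp add: diff_by_lin ev.ins_sum ev.ins_mult ev.ins_cst ev.ins_var)
  also have "\<dots> = eval4 v (cst (of_nat (Suc d)) * F)"
    by (simp only: euler_forms[OF Suc.prems] cst_of_nat)
  finally show ?case by (simp add: ev.ins_mult ev.ins_cst algebra_simps)
qed

text \<open>The second derivatives of the power are \<open>v i * v j\<close> times a common factor,
  so its Laplacian is a multiple of the value of the quadric at \<open>v\<close>.\<close>

lemma lin_power_harm:
  fixes A :: "4 \<Rightarrow> 4 \<Rightarrow> 'k::field_char_0"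
  assumes "eval4 v (quad A) = 0"
  shows "lin v ^ d \<in> harm A d"
proof (cases "d < 2")
  case True
  then show ?thesis using forms_power[OF lin_forms, of v d] by (simp add: harm_small)
next
  case False
  then obtain n where d: "d = Suc (Suc n)" by (metis One_nat_def Suc_1 less_Suc_eq not_less0 old.nat.exhaust)
  have "partial i (partial j (lin v ^ d)) = of_nat (Suc (Suc n)) * of_nat (Suc n) * lin v ^ n * cst (v i * v j)" for i j
  proof -
    have "partial j (lin v ^ d) = cst (of_nat (Suc (Suc n)) * v j) * lin v ^ Suc n"
      unfolding d partial_power partial_lin by (simp only: cst_mult cst_of_nat ac_simps)
    then have "partial i (partial j (lin v ^ d))
      = cst (of_nat (Suc (Suc n)) * v j) * (of_nat (Suc n) * lin v ^ n * cst (v i))"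
      by (simp only: partial_cst_mult partial_power partial_lin)
    then show ?thesis by (simp only: cst_mult cst_of_nat ac_simps)
  qed
  then have "diff_by (lin v ^ d) (quad A)
    = of_nat (Suc (Suc n)) * of_nat (Suc n) * lin v ^ n * cst (eval4 v (quad A))"
    unfolding diff_by_quad eval4_quad cst_sum sum_distrib_left
    by (intro sum.cong refl) (simp only: cst_mult ac_simps)
  then show ?thesis
    using assms forms_power[OF lin_forms, of v d] by (simp add: harm_def)
qed

text \<open>The functionals \<open>G\<close> to \<open>\<phi> (var k * G)\<close> are represented
  one degree lower by forms \<open>f k\<close>; Euler's identity shows that the sum of the
  \<open>var k * f k\<close>, divided by the degree, represents \<open>\<phi>\<close>.\<close>

lemma functional_representation:
  fixes \<phi> :: "'k::field_char_0 poly4 \<Rightarrow> 'k"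
  assumes add: "\<And>F G. \<phi> (F + G) = \<phi> F + \<phi> G" and cst: "\<And>c F. \<phi> (cst c * F) = c * \<phi> F"
  shows "\<exists>F\<in>forms d. \<forall>G\<in>forms d. diff_by F G = cst (\<phi> G)"
  using assms
proof (induction d arbitrary: \<phi>)
  case 0
  then show ?case
    using "0.prems"(2)[of _ 1]
    by (intro bexI[of _ "cst (\<phi> 1)"]) (auto elim!: forms_0_cst simp: forms_cst simp flip: cst_mult)
next
  case (Suc d)
  have "\<exists>F\<in>forms d. \<forall>G\<in>forms d. diff_by F G = cst (\<phi> (var k * G))" for k
    by (rule Suc.IH) (simp_all add: distrib_left Suc.prems mult.left_commute[of "var k" "cst _"])
  then obtain f where f: "\<And>k. f k \<in> forms d" "\<And>k G. G \<in> forms d \<Longrightarrow> diff_by (f k) G = cst (\<phi> (var k * G))"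
    by metis
  define F where "F = cst (inverse (of_nat (Suc d))) * (\<Sum>k\<in>UNIV. var k * f k)"
  have phi_sum: "\<phi> (\<Sum>k\<in>UNIV. g k) = (\<Sum>k\<in>UNIV. \<phi> (g k))" for g :: "4 \<Rightarrow> 'k poly4"
    by (simp add: sum_4 Suc.prems(1))
  have "diff_by F G = cst (\<phi> G)" if G: "G \<in> forms (Suc d)" for G
  proof -
    have "diff_by (\<Sum>k\<in>UNIV. var k * f k) G = cst (\<phi> (\<Sum>k\<in>UNIV. var k * partial k G))"
      unfolding phi_sum cst_sum diff_by_sum_left diff_by_times_var
      using G f by (intro sum.cong) (auto simp: diff_by_forms_0[of _ d _ "Suc d"] forms_partial)
    also have "\<dots> = cst (of_nat (Suc d) * \<phi> G)"
      unfolding euler_forms[OF G] using Suc.prems(2)[of "of_nat (Suc d)" G] by (simp only: cst_of_nat)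
    finally show ?thesis
      unfolding F_def diff_by_cst_mult_left by (simp del: of_nat_Suc flip: cst_mult)
  qed
  moreover have "F \<in> forms (Suc d)"
    unfolding F_def by (intro forms_cst_mult forms_sum forms_var_mult f)
  ultimately show ?case by blast
qed

text \<open>Restricting \<open>F\<close> to the line through \<open>v\<close> in direction
  \<open>i\<close> gives a univariate polynomial with every element of an infinite field as a root,
  hence zero. Its derivative at 0 is the value of \<open>partial i F\<close> at
  \<open>v\<close>.\<close>

lemma eval4_zero_partial:
  fixes F :: "'k::field_char_0 poly4"
  assumes "\<And>v. eval4 v F = 0"
  shows "eval4 v (partial i F) = 0"
proof -
  interpret line: insertion4 "\<lambda>c. [:c:]" "\<lambda>j. [:v j, if j = i then 1 else 0:]"
    by unfold_locales auto
  have "poly (line.ins F) s = eval4 (\<lambda>j. v j + s * (if j = i then 1 else 0)) F" for s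
    by (induction F rule: poly4_induct)
      (auto simp: line.ins_cst line.ins_var_mult line.ins_add ev.ins_cst ev.ins_var_mult ev.ins_add distrib_right)
  then have ins_0: "line.ins F = 0"
    using assms poly_all_0_iff_0[of "line.ins F"] by simp
  have pderiv: "pderiv (line.ins F) = line.ins (partial i F)"
    by (induction F rule: poly4_induct)
      (auto simp: line.ins_cst line.ins_var_mult line.ins_add pderiv_mult pderiv_smult pderiv_add pderiv_pCons partial_var_mult partial_add)
  have "poly (line.ins G) 0 = eval4 v G" for G
    by (induction G rule: poly4_induct)
      (auto simp: line.ins_cst line.ins_var_mult line.ins_add ev.ins_cst ev.ins_var_mult ev.ins_add)
  from this[of "partial i F"] show ?thesis by (simp add: ins_0 flip: pderiv)
qed

lemma forms_eval4_zero:
  fixes F :: "'k::field_char_0 poly4"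
  assumes "F \<in> forms d" "\<And>v. eval4 v F = 0"
  shows "F = 0"
  using assms
proof (induction d arbitrary: F)
  case 0
  then show ?case by (auto elim!: forms_0_cst simp: ev.ins_cst)
next
  case (Suc d)
  then have "partial i F = 0" for i
    by (intro Suc.IH forms_partial eval4_zero_partial)
  then show ?case using Suc.prems(1) forms_eqI_partial by blast
qed

lemma eval4_origin:
  fixes F :: "'k::field_char_0 poly4"
  assumes "F \<in> forms (Suc d)"
  shows "eval4 (\<lambda>_. 0) F = 0"
proof -
  have "eval4 (\<lambda>_. 0) (cst (of_nat (Suc d)) * F) = 0"
    unfolding cst_of_nat euler_forms[OF assms, symmetric] by (simp add: ev.ins_sum ev.ins_mult ev.ins_var)
  then show ?thesis by (simp add: ev.ins_mult ev.ins_cst del: of_nat_Suc)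
qed

section \<open>Divisibility by a quadric that has a rational point\<close>

context dual_quadrics
begin

text \<open>The cofactor is an arbitrary polynomial, so \<open>diff_by_quad_mult_eq_0\<close> is
  applied to each of its homogeneous components.\<close>

lemma harm_quad_dvd:
  assumes "Y \<in> harm A n" "quad B dvd Y"
  shows "Y = 0"
proof -
  obtain u where u: "Y = u * quad B" using assms(2) by (metis dvdE mult.commute)
  have "hcomp d u = 0" for d
  proof (rule diff_by_quad_mult_eq_0[OF hcomp_in_forms])
    have "quad B * hcomp d u = hcomp (d + 2) Y"
      unfolding u hcomp_mult[OF quad_forms] by (simp add: mult.commute)
    then show "diff_by (quad B * hcomp d u) (quad A) = 0"
      using hcomp_forms[OF harm_forms[OF assms(1)]] harm_diff_by[OF assms(1)] by simp
  qed
  then have "u = 0" using hcomp_decompose[of u] by auto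
  then show ?thesis by (simp add: u)
qed

end

locale isotropic_point = dual_quadrics A B for A B :: "4 \<Rightarrow> 4 \<Rightarrow> 'k::field_char_0" +
  fixes a :: "4 \<Rightarrow> 'k"
  assumes a_nonzero: "a \<noteq> (\<lambda>_. 0)" and a_isotropic: "eval4 a (quad A) = 0"
begin

definition Aa :: "4 \<Rightarrow> 'k" where
  "Aa i = (\<Sum>j\<in>UNIV. A i j * a j)"

text \<open>The derivative of \<open>quad A\<close> in direction \<open>a\<close>: an equation of
  the tangent plane of the quadric at the point \<open>a\<close>.\<close>

definition L :: "'k poly4" where
  "L = 2 * lin Aa"

lemma diff_by_quad_point: "diff_by (quad A) (lin a) = L"
proof -
  have "diff_by (quad A) (lin a) = (\<Sum>i\<in>UNIV. \<Sum>j\<in>UNIV. cst (a i * (2 * A i j)) * var j)"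
    unfolding diff_by_lin partial_quad[OF A_sym]
    by (simp add: sum_distrib_left cst_mult cst_numeral ac_simps)
  also have "\<dots> = (\<Sum>j\<in>UNIV. \<Sum>i\<in>UNIV. cst (a i * (2 * A i j)) * var j)" by (rule sum.swap)
  also have "\<dots> = (\<Sum>j\<in>UNIV. cst (2 * Aa j) * var j)"
  proof -
    have "(\<Sum>i\<in>UNIV. a i * (2 * A i j)) = 2 * Aa j" for j
      unfolding Aa_def sum_distrib_left by (intro sum.cong refl) (simp add: A_sym[of j])
    then show ?thesis by (simp only: flip: sum_distrib_right cst_sum)
  qed
  also have "\<dots> = L"
    by (simp add: L_def lin_def sum_distrib_left cst_mult cst_numeral mult.assoc)
  finally show ?thesis .
qed

lemma diff_by_L_point: "diff_by L (lin a) = 0"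
proof -
  have "(\<Sum>i\<in>UNIV. a i * Aa i) = eval4 a (quad A)"
    unfolding eval4_quad Aa_def by (simp add: sum_distrib_left ac_simps)
  then have "(\<Sum>i\<in>UNIV. cst (a i) * cst (Aa i)) = 0"
    by (simp add: a_isotropic flip: cst_mult cst_sum)
  then show ?thesis
    by (simp add: L_def diff_by_numeral_mult_left) (simp add: diff_by_lin partial_lin)
qed

lemma L_nonzero: "L \<noteq> 0"
proof
  assume "L = 0"
  then have "Aa = (\<lambda>_. 0)" by (simp add: L_def lin_eq_0_iff)
  then have "(\<Sum>j\<in>UNIV. B i j * Aa j) = 0" for i by simp
  moreover have "(\<Sum>j\<in>UNIV. B i j * Aa j) = a i" for i
  proof -
    have "(\<Sum>j\<in>UNIV. B i j * Aa j) = (\<Sum>k\<in>UNIV. (\<Sum>j\<in>UNIV. B i j * A j k) * a k)"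
      unfolding Aa_def sum_distrib_left sum_distrib_right by (subst sum.swap) (simp add: mult.assoc)
    also have "\<dots> = (\<Sum>k\<in>UNIV. if i = k then a k else 0)"
      unfolding B_A by (intro sum.cong) auto
    finally show ?thesis by simp
  qed
  ultimately show False using a_nonzero by auto
qed

text \<open>Differentiating the hypothesis in direction \<open>a\<close> gives the same relation for \<open>diff_by u (lin a)\<close> with
  \<open>N - 1\<close> in place of \<open>N\<close>.\<close>

lemma L_mult_eq_quad_mult_imp_0:
  assumes "u \<in> forms e" "e < N" "of_nat N * (L * u) = quad A * diff_by u (lin a)"
  shows "u = 0"
  using assms
proof (induction e arbitrary: u N)
  case 0
  then have "diff_by u (lin a) = 0" by (simp add: diff_by_lin forms_0_partial)
  with 0 show ?case by (simp add: of_nat_mult_eq_0_iff L_nonzero)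
next
  case (Suc e)
  define w where "w = diff_by u (lin a)"
  obtain M where M: "N = Suc M" using Suc.prems by (cases N) auto
  have "w \<in> forms e"
    unfolding w_def using Suc.prems lin_forms by (intro diff_by_forms[of _ 1]) auto
  moreover have "diff_by (cst (of_nat N) * (L * u)) (lin a) = diff_by (quad A * w) (lin a)"
    using Suc.prems by (simp add: w_def cst_of_nat)
  then have "of_nat M * (L * w) = quad A * diff_by w (lin a)"
    unfolding diff_by_cst_mult_left
    unfolding diff_by_lin_mult diff_by_quad_point diff_by_L_point w_def[symmetric]
    unfolding cst_of_nat M by (simp add: algebra_simps)
  ultimately have "w = 0" using Suc.IH[of w M] Suc.prems M by simp
  with Suc.prems show ?case by (simp add: of_nat_mult_eq_0_iff L_nonzero w_def)
qed

lemma L_forms: "L \<in> forms 1"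
  unfolding L_def using forms_cst_mult[OF lin_forms[of Aa], of 2] by (simp add: cst_numeral)

text \<open>Modulo \<open>quad A\<close>, \<open>F\<close> may be replaced by its part
  \<open>h\<close> harmonic for \<open>quad B\<close>. A suitable \<open>Y\<close>, congruent to a
  multiple of \<open>L * h\<close>, is harmonic as well as divisible by \<open>quad A\<close>, hence
  zero; the resulting relation forces \<open>h = 0\<close> by
  \<open>L_mult_eq_quad_mult_imp_0\<close>.\<close>

lemma quad_dvd_L_mult:
  assumes F: "F \<in> forms e" and dvd: "quad A dvd L * F"
  shows "quad A dvd F"
proof -
  obtain h u where h: "h \<in> harm B e" and F_eq: "F = h + quad A * u"
    using swap.harm_decompose[OF F] by blast
  define w where "w = diff_by h (lin a)"
  \<comment> \<open>The operator \<open>quad B\<close> sends \<open>L * h\<close> to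
    \<open>4 * w\<close> and \<open>quad A * w\<close> to \<open>4 * (e + 1)\<close> times
    \<open>w\<close>, so this combination is harmonic.\<close>
  define Y where "Y = of_nat (e + 1) * (L * h) - quad A * w"
  have w0: "w = 0" if "e = 0"
    unfolding w_def using harm_forms[OF h] that by (simp add: diff_by_lin forms_0_partial)
  have w: "w \<in> forms (e - 1)" "diff_by w (quad B) = 0"
  proof -
    show "w \<in> forms (e - 1)"
      unfolding w_def diff_by_lin by (intro forms_sum forms_cst_mult forms_partial_diff harm_forms[OF h])
    show "diff_by w (quad B) = 0"
      unfolding w_def by (simp add: diff_by_mult[symmetric] diff_by_mult_commute harm_diff_by[OF h] flip: mult.commute[of "quad B"])
  qed
  have lapw: "diff_by (quad A * w) (quad B) = of_nat (4 * (e + 1)) * w"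
    unfolding swap.diff_by_quad_mult_forms[OF w(1)] w(2) using w0 by (cases e) (auto simp: algebra_simps)
  have "diff_by (L * h) (quad B) = (\<Sum>k\<in>UNIV. 2 * (cst (Aa k) * diff_by (var k * h) (quad B)))"
    by (simp add: L_def lin_def mult.assoc sum_distrib_right diff_by_numeral_mult_left diff_by_sum_left
        diff_by_cst_mult_left sum_distrib_left)
  also have "\<dots> = (\<Sum>k\<in>UNIV. 4 * (cst (Aa k) * (\<Sum>j\<in>UNIV. cst (B k j) * partial j h)))"
    unfolding diff_by_times_var harm_diff_by[OF h] partial_quad[OF B_sym]
    by (simp add: diff_by_numeral_mult_right diff_by_sum_right diff_by_cst_mult_right)
  also have "\<dots> = 4 * (\<Sum>k\<in>UNIV. \<Sum>i\<in>UNIV. \<Sum>j\<in>UNIV. cst (A i k) * (cst (B k j) * (cst (a i) * partial j h)))"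
  proof -
    have "cst (Aa k) * S = (\<Sum>i\<in>UNIV. cst (A i k) * (cst (a i) * S))" for k and S :: "'k poly4"
      unfolding Aa_def cst_sum sum_distrib_right by (subst A_sym) (simp only: cst_mult mult.assoc)
    from this[of _ "\<Sum>j\<in>UNIV. cst (B _ j) * partial j h"]
    have "cst (Aa k) * (\<Sum>j\<in>UNIV. cst (B k j) * partial j h)
      = (\<Sum>i\<in>UNIV. \<Sum>j\<in>UNIV. cst (A i k) * (cst (B k j) * (cst (a i) * partial j h)))" for k
      by (simp only: sum_distrib_left) (simp only: ac_simps)
    then show ?thesis by (simp only: sum_distrib_left[symmetric])
  qed
  also have "(\<Sum>k\<in>UNIV. \<Sum>i\<in>UNIV. \<Sum>j\<in>UNIV. cst (A i k) * (cst (B k j) * (cst (a i) * partial j h)))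
    = (\<Sum>i\<in>UNIV. \<Sum>k\<in>UNIV. \<Sum>j\<in>UNIV. cst (A i k) * (cst (B k j) * (cst (a i) * partial j h)))"
    by (rule sum.swap)
  also have "\<dots> = w"
    unfolding swap.sum_B_A w_def diff_by_lin ..
  finally have lapL: "diff_by (L * h) (quad B) = 4 * w" .
  have "diff_by Y (quad B) = 0"
  proof -
    have "diff_by (of_nat (e + 1) * (L * h)) (quad B) = of_nat (e + 1) * (4 * w)"
      unfolding lapL[symmetric] using diff_by_cst_mult_left[of "of_nat (e + 1)" "L * h" "quad B"]
      by (simp only: cst_of_nat)
    then show ?thesis
      unfolding Y_def diff_by_diff_left lapw by simp
  qed
  moreover have "Y \<in> forms (Suc e)"
  proof -
    have "L * h \<in> forms (Suc e)" using forms_mult[OF L_forms harm_forms[OF h]] by simp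
    then have "of_nat (e + 1) * (L * h) \<in> forms (Suc e)"
      using forms_cst_mult[of "L * h" _ "of_nat (e + 1)"] by (simp only: cst_of_nat)
    moreover have "quad A * w \<in> forms (Suc e)"
      using forms_mult[OF quad_forms[of A] w(1)] w0 by (cases e) auto
    ultimately show ?thesis unfolding Y_def by (rule forms_diff)
  qed
  ultimately have "Y \<in> harm B (Suc e)" by (simp add: harm_def)
  moreover have "quad A dvd L * h"
  proof -
    have "L * h = L * F - quad A * (L * u)" by (simp add: F_eq algebra_simps)
    then show ?thesis using dvd by (simp add: dvd_diff)
  qed
  then have "quad A dvd Y" unfolding Y_def by (intro dvd_diff) auto
  ultimately have "Y = 0" using swap.harm_quad_dvd by blast
  then have "h = 0"
    using L_mult_eq_quad_mult_imp_0[OF harm_forms[OF h], of "e + 1"] by (simp add: Y_def w_def)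
  then show ?thesis by (simp add: F_eq)
qed

lemma quad_dvd_L_power_mult:
  assumes "F \<in> forms e" "quad A dvd L ^ n * F"
  shows "quad A dvd F"
  using assms(2)
proof (induction n)
  case (Suc n)
  have "L ^ n * F \<in> forms (n + e)"
    using forms_mult[OF forms_power[OF L_forms, of n] assms(1)] by simp
  moreover have "quad A dvd L * (L ^ n * F)"
    using Suc.prems by (simp only: power_Suc mult.assoc)
  ultimately have "quad A dvd L ^ n * F" by (rule quad_dvd_L_mult)
  then show ?case by (rule Suc.IH)
qed simp

text \<open>Up to the factor \<open>Q(w)\<close>, the reflection of \<open>a\<close> in the hyperplane orthogonal to \<open>w\<close>. Since \<open>k\<close> is
  infinite, vanishing at all these points becomes a polynomial identity in \<open>w\<close>.\<close>

definition cone_point :: "(4 \<Rightarrow> 'k) \<Rightarrow> 4 \<Rightarrow> 'k" where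
  "cone_point w = (\<lambda>i. eval4 w (quad A) * a i - eval4 w L * w i)"

lemma eval4_L: "eval4 w L = 2 * (\<Sum>i\<in>UNIV. Aa i * w i)"
  using ev.ins_cst_mult[of w 2 "lin Aa"] by (simp add: L_def eval4_lin cst_numeral)

text \<open>With \<open>q\<close> and \<open>l\<close> the values of \<open>quad A\<close> and
  \<open>L\<close> at \<open>w\<close>, the terms \<open>- q * l * l\<close> and
  \<open>l * l * q\<close> cancel, and the term in \<open>q * q\<close> carries the value of
  \<open>quad A\<close> at \<open>a\<close>, which is zero.\<close>

lemma cone_point_isotropic: "eval4 (cone_point w) (quad A) = 0"
proof -
  let ?q = "eval4 w (quad A)" and ?l = "eval4 w L"
  have l1: "2 * (\<Sum>i\<in>UNIV. \<Sum>j\<in>UNIV. A i j * (w i * a j)) = ?l"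
    unfolding eval4_L Aa_def by (simp add: sum_distrib_left sum_distrib_right ac_simps)
  have l2: "(\<Sum>i\<in>UNIV. \<Sum>j\<in>UNIV. A i j * (a i * w j)) = (\<Sum>i\<in>UNIV. \<Sum>j\<in>UNIV. A i j * (w i * a j))"
    by (subst sum.swap, intro sum.cong refl, subst A_sym) simp
  have "eval4 (cone_point w) (quad A)
    = (\<Sum>i\<in>UNIV. \<Sum>j\<in>UNIV. ?q * ?q * (A i j * (a i * a j)) - ?q * ?l * (A i j * (a i * w j))
        - ?q * ?l * (A i j * (w i * a j)) + ?l * ?l * (A i j * (w i * w j)))"
    unfolding eval4_quad[of "cone_point w"] unfolding cone_point_def by (intro sum.cong refl) (simp add: algebra_simps)
  also have "\<dots> = ?q * ?q * eval4 a (quad A) - ?q * ?l * (\<Sum>i\<in>UNIV. \<Sum>j\<in>UNIV. A i j * (a i * w j))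
      - ?q * ?l * (\<Sum>i\<in>UNIV. \<Sum>j\<in>UNIV. A i j * (w i * a j)) + ?l * ?l * ?q"
    unfolding eval4_quad by (simp only: sum.distrib sum_subtractf sum_distrib_left)
  also have "\<dots> = ?q * ?q * 0 - ?q * ?l * (2 * (\<Sum>i\<in>UNIV. \<Sum>j\<in>UNIV. A i j * (w i * a j))) + ?l * ?l * ?q"
    unfolding l2 a_isotropic by (simp add: algebra_simps)
  also have "\<dots> = 0" unfolding l1 by simp
  finally show ?thesis .
qed

text \<open>The polynomial version of \<open>cone_point\<close>, with the coordinates of
  \<open>w\<close> as variables.\<close>

interpretation cone: insertion4 cst "\<lambda>i. cst (a i) * quad A - L * var i"
  by unfold_locales (simp_all add: cst_add cst_mult)

lemma eval4_cone: "eval4 w (cone.ins F) = eval4 (cone_point w) F"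
  by (induction F rule: poly4_induct)
    (simp_all add: cone.ins_cst cone.ins_var_mult cone.ins_add ev.ins_cst ev.ins_var_mult ev.ins_add ev.ins_diff
      ev.ins_mult ev.ins_var cone_point_def)

lemma cone_ins_forms: "F \<in> forms d \<Longrightarrow> cone.ins F \<in> forms (2 * d)"
proof (induction F rule: forms_induct)
  case (cst c)
  then show ?case by (simp add: cone.ins_cst forms_cst)
next
  case (var_mult d i F)
  have "L * var i \<in> forms 2" using forms_mult[OF L_forms forms_var] by (simp add: numeral_2_eq_2)
  then have "cst (a i) * quad A - L * var i \<in> forms 2"
    by (intro forms_diff forms_cst_mult quad_forms)
  from forms_mult[OF this var_mult.IH] show ?case by (simp add: cone.ins_var_mult)
qed (simp_all add: cone.ins_add forms_add)

text \<open>Modulo \<open>quad A\<close> the substitution sends each variable to \<open>- L\<close>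
  times itself.\<close>

lemma cone_ins_cong: "F \<in> forms d \<Longrightarrow> quad A dvd cone.ins F - (- L) ^ d * F"
proof (induction F rule: forms_induct)
  case (var_mult d i F)
  have "cone.ins (var i * F) - (- L) ^ Suc d * (var i * F)
    = quad A * (cst (a i) * cone.ins F) - L * var i * (cone.ins F - (- L) ^ d * F)"
    unfolding cone.ins_var_mult by (simp add: algebra_simps)
  then show ?case
    by (simp only:) (intro dvd_diff dvd_triv_left dvd_mult var_mult.IH)
next
  case (add d F G)
  have "cone.ins (F + G) - (- L) ^ d * (F + G) = (cone.ins F - (- L) ^ d * F) + (cone.ins G - (- L) ^ d * G)"
    unfolding cone.ins_add by (simp add: algebra_simps)
  then show ?case by (simp only:) (intro dvd_add add.IH)
qed (simp_all add: cone.ins_cst)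

text \<open>Vanishing at all cone points makes the substituted polynomial zero, so
  \<open>quad A\<close> divides a power of \<open>L\<close> times \<open>F\<close>, and
  \<open>L\<close> can be cancelled. Positive degree covers those \<open>w\<close> whose cone point
  is the zero vector.\<close>

lemma quad_dvd_if_vanishes:
  assumes F: "F \<in> forms (Suc d)" and zero: "\<And>v. v \<in> proj_zeros (quad A) \<Longrightarrow> eval4 v F = 0"
  shows "quad A dvd F"
proof -
  have "eval4 (cone_point w) F = 0" for w
  proof (cases "cone_point w = (\<lambda>_. 0)")
    case True
    then show ?thesis using eval4_origin[OF F] by simp
  next
    case False
    then show ?thesis using zero cone_point_isotropic by (simp add: proj_zeros_def)
  qed
  then have "cone.ins F = 0"
    using forms_eval4_zero[OF cone_ins_forms[OF F]] eval4_cone by simp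
  then have "quad A dvd (- L) ^ Suc d * F"
    using cone_ins_cong[OF F] by simp
  then have "quad A dvd L ^ Suc d * F"
    by (cases "even (Suc d)") (auto simp: power_minus_even power_minus_odd simp del: power_Suc)
  then show ?thesis using quad_dvd_L_power_mult[OF F] by blast
qed

end

lemma span_smul_subset_ideal:
  fixes S :: "'k::field poly4 set"
  shows "Modules.module.span smul S \<subseteq> ideal_gen S"
proof -
  interpret V: vector_space "smul :: 'k \<Rightarrow> 'k poly4 \<Rightarrow> 'k poly4" by (rule vector_space_smul)
  show ?thesis
    by (rule V.span_minimal[OF ideal_gen_superset])
      (auto simp: V.subspace_def smul_cst intro: ideal_gen_add ideal_gen_mult)
qed

lemma separating_functional:
  fixes h :: "'k::field poly4"
  assumes "h \<notin> Modules.module.span smul S"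
  obtains \<phi> :: "'k poly4 \<Rightarrow> 'k" where "\<And>F G. \<phi> (F + G) = \<phi> F + \<phi> G" "\<And>c F. \<phi> (cst c * F) = c * \<phi> F"
    "\<And>x. x \<in> S \<Longrightarrow> \<phi> x = 0" "\<phi> h = 1"
proof -
  interpret V: vector_space "smul :: 'k \<Rightarrow> 'k poly4 \<Rightarrow> 'k poly4" by (rule vector_space_smul)
  interpret P: vector_space_pair "smul :: 'k \<Rightarrow> 'k poly4 \<Rightarrow> 'k poly4" "(*) :: 'k \<Rightarrow> 'k \<Rightarrow> 'k"
    by unfold_locales (simp_all add: algebra_simps)
  obtain C where C: "C \<subseteq> S" "V.independent C" "S \<subseteq> V.span C"
    using V.maximal_independent_subset by blast
  then have h: "h \<notin> V.span C" using assms V.span_mono by blast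
  then have "V.independent (insert h C)" using C(2) by (rule V.independent_insertI)
  then obtain g where g: "Vector_Spaces.linear smul (*) g" "\<forall>x\<in>insert h C. g x = (if x = h then 1 else 0)"
    using P.linear_independent_extend[of "insert h C" "\<lambda>x. if x = h then 1 else 0"] by blast
  interpret g: Vector_Spaces.linear smul "(*)" g by (rule g(1))
  have "h \<notin> C" using h V.span_base by blast
  then have "g x = 0" if "x \<in> C" for x using that g(2) by auto
  then have "g x = 0" if "x \<in> S" for x
    using P.linear_eq_0_on_span[OF g(1), of C x] C(3) that by blast
  then show ?thesis
    using that[of g] g.add g.scale g(2) by (simp add: smul_cst)
qed

context isotropic_point
begin

lemma harm_subset_span:
  "harm A (Suc d) \<subseteq> Modules.module.span smul {lin v ^ Suc d | v. v \<in> proj_zeros (quad A)}"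
proof
  fix h assume h: "h \<in> harm A (Suc d)"
  show "h \<in> Modules.module.span smul {lin v ^ Suc d | v. v \<in> proj_zeros (quad A)}"
  proof (rule ccontr)
    assume "\<not> ?thesis"
    then obtain \<phi> :: "'k poly4 \<Rightarrow> 'k" where phi: "\<And>F G. \<phi> (F + G) = \<phi> F + \<phi> G" "\<And>c F. \<phi> (cst c * F) = c * \<phi> F"
        "\<And>v. v \<in> proj_zeros (quad A) \<Longrightarrow> \<phi> (lin v ^ Suc d) = 0" "\<phi> h = 1"
      by (rule separating_functional) blast
    obtain F where F: "F \<in> forms (Suc d)" "\<And>G. G \<in> forms (Suc d) \<Longrightarrow> diff_by F G = cst (\<phi> G)"
      using functional_representation[of \<phi> "Suc d"] phi(1,2) by blast
    have "eval4 v F = 0" if "v \<in> proj_zeros (quad A)" for v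
    proof -
      have "lin v ^ Suc d \<in> forms (Suc d)"
        using forms_power[OF lin_forms, of v "Suc d"] by simp
      then have "cst (fact (Suc d) * eval4 v F) = cst 0"
        using F(2) diff_by_lin_power[OF F(1), of v] phi(3)[OF that] by metis
      then show ?thesis by (simp del: fact_Suc cst_simps)
    qed
    then obtain g where g: "F = quad A * g"
      using quad_dvd_if_vanishes[OF F(1)] by (blast elim: dvdE)
    \<comment> \<open>Symmetry of the pairing moves the factor \<open>quad A\<close> of
      \<open>F\<close> onto \<open>h\<close>, where it acts as the Laplacian and gives zero.\<close>
    have "diff_by F h = diff_by (diff_by h (quad A)) g"
      using diff_by_symmetric[OF F(1) harm_forms[OF h]] by (simp add: g diff_by_mult_commute)
    then show False
      using F(2)[OF harm_forms[OF h]] phi(4) harm_diff_by[OF h] by simp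
  qed
qed

lemma dual_power_ideal_eq_harm: "dual_power_ideal (quad A) (Suc t) = ideal_gen (harm A (Suc t))"
proof -
  have "{l ^ Suc t | l. l \<in> forms 1 \<and> l \<noteq> 0 \<and> dual_point l \<in> proj_zeros (quad A)}
    = {lin v ^ Suc t | v. v \<in> proj_zeros (quad A)}" (is "?S = ?T")
  proof safe
    fix l :: "'k poly4" assume "l \<in> forms 1" "dual_point l \<in> proj_zeros (quad A)"
    then show "\<exists>v. l ^ Suc t = lin v ^ Suc t \<and> v \<in> proj_zeros (quad A)"
      by (metis lin_dual_point)
  next
    fix v assume v: "v \<in> proj_zeros (quad A)"
    then have "lin v \<noteq> 0" by (simp add: lin_eq_0_iff proj_zeros_def)
    then show "\<exists>l. lin v ^ Suc t = l ^ Suc t \<and> l \<in> forms 1 \<and> l \<noteq> 0 \<and> dual_point l \<in> proj_zeros (quad A)"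
      using v lin_forms dual_point_lin by metis
  qed
  moreover have "ideal_gen ?T = ideal_gen (harm A (Suc t))"
  proof
    show "ideal_gen ?T \<subseteq> ideal_gen (harm A (Suc t))"
    proof (rule ideal_gen_subsetI, safe)
      fix v assume "v \<in> proj_zeros (quad A)"
      then have "lin v ^ Suc t \<in> harm A (Suc t)" by (intro lin_power_harm) (simp add: proj_zeros_def)
      then show "lin v ^ Suc t \<in> ideal_gen (harm A (Suc t))" using ideal_gen_superset by blast
    qed
    show "ideal_gen (harm A (Suc t)) \<subseteq> ideal_gen ?T"
      using harm_subset_span span_smul_subset_ideal by (intro ideal_gen_subsetI) blast
  qed
  ultimately show ?thesis by (simp add: dual_power_ideal_def)
qed

end

lemma (in dual_quadrics) dual_power_ideal_eq:
  assumes "proj_zeros (quad A) \<noteq> {}"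
  shows "dual_power_ideal (quad A) (Suc t) = ideal_gen (harm A (Suc t))"
proof -
  obtain a where "a \<in> proj_zeros (quad A)" using assms by blast
  then interpret isotropic_point A B a by unfold_locales (simp_all add: proj_zeros_def)
  show ?thesis by (rule dual_power_ideal_eq_harm)
qed

section \<open>Hilbert functions and base change\<close>

context vector_space
begin

text \<open>The polynomial ring is infinite-dimensional, so finiteness of bases is obtained relative
  to a finite spanning set.\<close>

lemma finite_span_basis:
  assumes "finite S" "W \<subseteq> span S"
  obtains C where "finite C" "independent C" "C \<subseteq> W" "W \<subseteq> span C" "card C = dim W"
proof -
  obtain C where C: "C \<subseteq> W" "independent C" "W \<subseteq> span C" "card C = dim W"
    using basis_exists by blast
  moreover have "finite C"
    using independent_span_bound[OF assms(1) C(2)] C(1) assms(2) by blast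
  ultimately show ?thesis using that by blast
qed

lemma dim_mono_finite_span:
  assumes "finite S" "W \<subseteq> span S" "U \<subseteq> W"
  shows "dim U \<le> dim W"
proof -
  obtain C where C: "finite C" "W \<subseteq> span C" "card C = dim W"
    using finite_span_basis assms(1,2) by metis
  obtain C' where C': "independent C'" "C' \<subseteq> U" "card C' = dim U"
    using finite_span_basis[of S U] assms by (metis order_trans)
  show ?thesis
    using independent_span_bound[OF C(1) C'(1)] C C' assms(3) by auto
qed

lemma dim_strict_mono_finite_span:
  assumes "finite S" "W \<subseteq> span S" "U \<subset> W" "subspace U"
  shows "dim U < dim W"
proof -
  obtain C where C: "finite C" "W \<subseteq> span C" "card C = dim W"
    using finite_span_basis assms(1,2) by metis
  obtain C' where C': "finite C'" "independent C'" "C' \<subseteq> U" "card C' = dim U"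
    using finite_span_basis[of S U] assms by (metis order_trans psubset_imp_subset)
  obtain x where x: "x \<in> W" "x \<notin> U" using assms(3) by blast
  then have nx: "x \<notin> span C'" using span_minimal[OF C'(3) assms(4)] by blast
  then have "independent (insert x C')" using C'(2) by (rule independent_insertI)
  moreover have "insert x C' \<subseteq> span C" using x C C' assms(3) by blast
  ultimately have "card (insert x C') \<le> card C" using independent_span_bound[OF C(1)] by blast
  moreover have "x \<notin> C'" using nx span_base by blast
  ultimately show ?thesis using C C' by simp
qed

end

text \<open>A basis \<open>C\<close> of the kernel is extended to a basis \<open>D\<close> of
  \<open>V\<close>; the vectors of \<open>D - C\<close> map injectively onto a basis of the
  image.\<close>

lemma (in vector_space) rank_nullity_finite_span:
  assumes f: "Vector_Spaces.linear scale scale f" and S: "finite S" "V \<subseteq> span S" "subspace V"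
  shows "dim V = dim (f ` V) + dim {x \<in> V. f x = 0}"
proof -
  interpret f: Vector_Spaces.linear scale scale f by (rule f)
  let ?K = "{x \<in> V. f x = 0}"
  obtain C where C: "finite C" "independent C" "C \<subseteq> ?K" "?K \<subseteq> span C" "card C = dim ?K"
    using finite_span_basis[of S ?K] S by blast
  obtain D where D: "C \<subseteq> D" "D \<subseteq> V" "independent D" "V \<subseteq> span D"
    using maximal_independent_subset_extend[of C V] C by blast
  have finD: "finite D" using independent_span_bound[OF S(1) D(3)] D(2) S(2) by blast
  have spanD: "span D = V" using D S(3) by (metis span_minimal subset_antisym)
  let ?E = "D - C"
  have ker: "x = 0" if "x \<in> span ?E" "f x = 0" for x
  proof -
    have "x \<in> V" using that(1) spanD span_mono[of ?E D] by blast
    then have "x \<in> span C" using that C(4) by blast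
    \<comment> \<open>The coordinates of \<open>x\<close> are supported both in \<open>D - C\<close>
      and in \<open>C\<close>, hence nowhere.\<close>
    then have "representation D x b = 0" for b
      using representation_extend[OF D(3) that(1), of] representation_extend[OF D(3), of x C] D(1)
        representation_ne_zero[of ?E x b] representation_ne_zero[of C x b] by auto
    then show ?thesis
      using sum_nonzero_representation_eq[OF D(3), of x] \<open>x \<in> V\<close> D(4) by auto
  qed
  have inj: "inj_on f (span ?E)"
    using ker by (auto simp: f.inj_on_iff_eq_0)
  have "independent (f ` ?E)"
    by (rule f.independent_injective_image[OF independent_mono[OF D(3)] inj]) blast
  moreover have "f ` V \<subseteq> span (f ` ?E)"
  proof -
    have "f x \<in> span (f ` ?E)" if "x \<in> D" for x
      using that C(3) span_zero by (cases "x \<in> C") (auto intro: span_base)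
    then have "span (f ` D) \<subseteq> span (f ` ?E)"
      by (intro span_minimal) auto
    then show ?thesis using f.span_image[of D] spanD by simp
  qed
  moreover have "f ` ?E \<subseteq> f ` V" using D(2) by blast
  ultimately have "dim (f ` V) = card (f ` ?E)"
    using basis_card_eq_dim by metis
  also have "\<dots> = card ?E"
    using inj span_superset by (meson card_image inj_on_subset)
  finally have "dim (f ` V) = card D - card C"
    using D(1) C(1) by (simp add: card_Diff_subset)
  moreover have "dim V = card D"
    using D basis_card_eq_dim by metis
  moreover have "card C \<le> card D" using D(1) finD by (rule card_mono[rotated])
  ultimately show ?thesis using C(5) by simp
qed

section \<open>Finiteness and the Gorenstein property of the annihilator quotient\<close>

lemma finite_expo_degree: "finite {m. expo_degree m = d}"
proof (induction d)
  case 0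
  then show ?case by (simp add: expo_degree_eq_0_iff)
next
  case (Suc d)
  have "{m. expo_degree m = Suc d} \<subseteq> (\<Union>i\<in>UNIV. (+) (Poly_Mapping.single i 1) ` {m. expo_degree m = d})"
  proof safe
    fix m assume m: "expo_degree m = Suc d"
    then obtain i where "Poly_Mapping.lookup m i > 0"
      by (metis expo_degree_def gr0I nat.distinct(1) sum.neutral)
    from expo_split[OF this] obtain m' where m': "m = Poly_Mapping.single i 1 + m'" by blast
    then have "expo_degree m' = d" using m by (simp add: expo_degree_add)
    then show "m \<in> (\<Union>i\<in>UNIV. (+) (Poly_Mapping.single i 1) ` {m. expo_degree m = d})"
      using m' by blast
  qed
  then show ?case using Suc finite_subset by fastforce
qed

definition monomials :: "nat \<Rightarrow> 'k::comm_ring_1 poly4 set" where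
  "monomials d = (\<lambda>m. Poly_Mapping.single m 1) ` {m. expo_degree m = d}"

lemma finite_monomials: "finite (monomials d)"
  by (simp add: monomials_def finite_expo_degree)

interpretation V: vector_space "smul :: 'k::field \<Rightarrow> 'k poly4 \<Rightarrow> 'k poly4"
  by (rule vector_space_smul)

lemma forms_subset_span: "forms d \<subseteq> V.span (monomials d)"
proof
  fix F :: "'k::field poly4" assume F: "F \<in> forms d"
  have "Poly_Mapping.single m (Poly_Mapping.lookup F m) \<in> V.span (monomials d)" if "m \<in> Poly_Mapping.keys F" for m
  proof -
    have "Poly_Mapping.single m (Poly_Mapping.lookup F m) = smul (Poly_Mapping.lookup F m) (Poly_Mapping.single m 1)"
      by (simp add: smul_def mult_single)
    moreover have "Poly_Mapping.single m 1 \<in> monomials d"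
      using F that by (auto simp: monomials_def forms_def)
    ultimately show ?thesis by (metis V.span_base V.span_scale)
  qed
  then have "(\<Sum>m\<in>Poly_Mapping.keys F. Poly_Mapping.single m (Poly_Mapping.lookup F m)) \<in> V.span (monomials d)"
    by (rule V.span_sum)
  then show "F \<in> V.span (monomials d)" unfolding poly_mapping_sum_single .
qed

lemma subspace_forms: "V.subspace (forms d)"
  by (auto simp: V.subspace_def smul_cst forms_add forms_cst_mult)

lemma is_ideal_subspace: "is_ideal I \<Longrightarrow> V.subspace I"
  by (auto simp: V.subspace_def is_ideal_iff smul_cst)

lemma linear_diff_by: "Vector_Spaces.linear smul smul (diff_by (F :: 'k::field poly4))"
  unfolding Vector_Spaces.linear_iff
  by (simp add: vector_space_smul smul_cst diff_by_add_right diff_by_cst_mult_right)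

lemma diff_by_in_span:
  fixes F :: "'k::field poly4"
  assumes "F \<in> forms D"
  shows "diff_by F G \<in> V.span (\<Union>d\<le>D. monomials d)"
proof -
  have "diff_by F (hcomp d G) \<in> V.span (\<Union>d\<le>D. monomials d)" for d
  proof (cases "d \<le> D")
    case True
    then have "diff_by F (hcomp d G) \<in> forms (D - d)"
      using assms by (intro diff_by_forms[of _ d]) auto
    then show ?thesis
      using forms_subset_span V.span_mono[of "monomials (D - d)" "\<Union>d\<le>D. monomials d"] by fastforce
  qed (use diff_by_forms_0[OF assms hcomp_in_forms] V.span_zero in auto)
  then have *: "diff_by F (\<Sum>d<n. hcomp d G) \<in> V.span (\<Union>d\<le>D. monomials d)" for n
    unfolding diff_by_sum_right by (intro V.span_sum)
  obtain n where "G = (\<Sum>d<n. hcomp d G)" using hcomp_decompose by blast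
  with *[of n] show ?thesis by simp
qed

text \<open>Ideals containing the kernel of \<open>diff_by F\<close> are determined by their images,
  which are subspaces of a finite-dimensional space. A strictly descending chain would make the
  dimensions of the images decrease forever.\<close>

lemma artinian_quotient_perp:
  fixes F :: "'k::field poly4"
  assumes "F \<in> forms D"
  shows "artinian_quotient (perp F)"
  unfolding artinian_quotient_def
proof safe
  fix J :: "nat \<Rightarrow> 'k poly4 set"
  assume J: "\<forall>n. is_ideal (J n) \<and> perp F \<subseteq> J n \<and> J (Suc n) \<subset> J n"
  interpret f: Vector_Spaces.linear smul smul "diff_by F" by (rule linear_diff_by)
  have "V.dim (diff_by F ` J (Suc n)) < V.dim (diff_by F ` J n)" for n
  proof (rule V.dim_strict_mono_finite_span)
    show "finite (\<Union>d\<le>D. monomials d :: 'k poly4 set)" by (simp add: finite_monomials)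
    show "diff_by F ` J n \<subseteq> V.span (\<Union>d\<le>D. monomials d)"
      using diff_by_in_span[OF assms] by blast
    show "V.subspace (diff_by F ` J (Suc n))"
      using J is_ideal_subspace f.subspace_image by blast
    obtain x where x: "x \<in> J n" "x \<notin> J (Suc n)" using J by blast
    have "diff_by F x \<notin> diff_by F ` J (Suc n)"
    proof
      assume "diff_by F x \<in> diff_by F ` J (Suc n)"
      then obtain y where y: "y \<in> J (Suc n)" "diff_by F (x - y) = 0"
        by (auto simp: diff_by_diff_right)
      then have "x - y \<in> J (Suc n)" using J perp_eq_annihilator[OF assms] by blast
      then have "(x - y) + y \<in> J (Suc n)" using J y(1) unfolding is_ideal_iff by blast
      then show False using x(2) by simp
    qed
    then show "diff_by F ` J (Suc n) \<subset> diff_by F ` J n" using x(1) J by blast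
  qed
  then have "V.dim (diff_by F ` J n) + n \<le> V.dim (diff_by F ` J 0)" for n
  proof (induction n)
    case (Suc n)
    have "V.dim (diff_by F ` J (Suc n)) < V.dim (diff_by F ` J n)" by (rule Suc.prems)
    then show ?case using Suc.IH[OF Suc.prems] by linarith
  qed simp
  from this[of "Suc (V.dim (diff_by F ` J 0))"] show False by simp
qed

lemma homogeneous_ideal_perp:
  assumes "F \<in> forms D"
  shows "homogeneous_ideal (perp F)"
  unfolding homogeneous_ideal_def
proof
  show "ideal_gen {G \<in> perp F. \<exists>d. G \<in> forms d} \<subseteq> perp F"
    unfolding perp_def by (rule ideal_gen_minimal[OF _ is_ideal_ideal_gen]) auto
  have "{G. (\<exists>d. G \<in> forms d) \<and> diff_by F G = 0} \<subseteq> {G \<in> perp F. \<exists>d. G \<in> forms d}"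
    using perp_eq_annihilator[OF assms] by auto
  then show "perp F \<subseteq> ideal_gen {G \<in> perp F. \<exists>d. G \<in> forms d}"
    unfolding perp_def[of F] using ideal_gen_superset by (intro ideal_gen_subsetI) blast
qed

context dual_quadrics
begin

text \<open>Through \<open>diff_by (quad A ^ t)\<close>, multiplication by a variable becomes a
  partial derivative, so the socle corresponds to the polynomials with vanishing derivatives, that
  is, the constants.\<close>

lemma gorenstein_quotient_perp: "gorenstein_quotient (perp (quad A ^ t)) (2 * t)"
  unfolding gorenstein_quotient_def
proof (intro conjI)
  show "homogeneous_ideal (perp (quad A ^ t))" by (rule homogeneous_ideal_perp[OF quad_power_forms])
  show "artinian_quotient (perp (quad A ^ t))" by (rule artinian_quotient_perp[OF quad_power_forms])
  obtain c where c: "c \<noteq> 0" "diff_by (quad A ^ t) (quad B ^ t) = cst c"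
    using diff_by_power_power_dual[of t 0] by auto
  \<comment> \<open>Normalized to be sent to 1, so that the scalar \<open>c\<close> in the socle
    condition is the constant to which \<open>F\<close> is sent.\<close>
  define s where "s = cst (inverse c) * quad B ^ t"
  have s: "diff_by (quad A ^ t) s = 1"
    using c(1) by (simp add: s_def diff_by_cst_mult_right c(2) flip: cst_mult)
  have "(\<forall>i. var i * F \<in> perp (quad A ^ t)) \<longleftrightarrow> (\<exists>c. F - smul c s \<in> perp (quad A ^ t))" for F
  proof -
    have "(\<forall>i. partial i G = 0) \<longleftrightarrow> (\<exists>c. G = cst c)" for G :: "'k poly4"
    proof
      assume "\<forall>i. partial i G = 0"
      then have "G \<in> forms 0" by (simp add: forms_iff_euler euler_def)
      then show "\<exists>c. G = cst c" by (auto elim: forms_0_cst)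
    qed auto
    then show ?thesis
      by (simp add: perp_eq_annihilator[OF quad_power_forms] diff_by_var_mult diff_by_diff_right smul_cst
          diff_by_cst_mult_right s)
  qed
  moreover have "s \<in> forms (2 * t)"
    unfolding s_def by (intro forms_cst_mult swap.quad_power_forms)
  moreover have "s \<notin> perp (quad A ^ t)"
    using s by (simp add: perp_eq_annihilator[OF quad_power_forms])
  ultimately show "\<exists>s\<in>forms (2 * t). s \<notin> perp (quad A ^ t) \<and>
      (\<forall>F. (\<forall>i. var i * F \<in> perp (quad A ^ t)) \<longleftrightarrow> (\<exists>c. F - smul c s \<in> perp (quad A ^ t)))"
    by blast
qed

text \<open>By rank and nullity the Hilbert function is the dimension of the image of
  \<open>forms i\<close>. The map is injective for \<open>i \<le> t\<close> and onto
  \<open>forms (2 * t - i)\<close> beyond, and each case also yields the inequality that selects the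
  minimum.\<close>

lemma hilbert_fun_perp:
  assumes "i \<le> 2 * t"
  shows "hilbert_fun (perp (quad A ^ t)) i
    = min (dim_k (forms i :: 'k poly4 set)) (dim_k (forms (2 * t - i) :: 'k poly4 set))"
proof -
  let ?T = "diff_by (quad A ^ t)"
  have K: "perp (quad A ^ t) \<inter> forms i = {G \<in> forms i. ?T G = 0}"
    by (auto simp: perp_eq_annihilator[OF quad_power_forms])
  have rank: "V.dim (forms i :: 'k poly4 set) = V.dim (?T ` forms i) + V.dim (perp (quad A ^ t) \<inter> forms i)"
    unfolding K by (rule V.rank_nullity_finite_span[OF linear_diff_by finite_monomials forms_subset_span subspace_forms])
  have sub: "?T ` forms i \<subseteq> forms (2 * t - i)"
    using assms quad_power_forms[of t] by (auto intro!: diff_by_forms[of _ i])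
  then have le: "V.dim (?T ` forms i) \<le> V.dim (forms (2 * t - i) :: 'k poly4 set)"
    by (rule V.dim_mono_finite_span[OF finite_monomials forms_subset_span])
  show ?thesis
  proof (cases "i \<le> t")
    case True
    then have "perp (quad A ^ t) \<inter> forms i = {0}"
      unfolding K using diff_by_power_inj by auto
    moreover have "V.dim {0 :: 'k poly4} = 0"
      by (rule V.dim_unique[of "{}"]) (auto simp: V.independent_empty)
    ultimately show ?thesis using rank le unfolding hilbert_fun_def by simp
  next
    case False
    have "forms (2 * t - i) \<subseteq> ?T ` forms i"
    proof
      fix F :: "'k poly4" assume "F \<in> forms (2 * t - i)"
      then obtain P where "P \<in> forms (2 * t - (2 * t - i))" "F = ?T P"
        using diff_by_power_surj False by (metis diff_le_mono2 diff_mult_distrib2 le_diff_conv2 linorder_le_cases mult_2 add_diff_cancel_right' assms)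
      then show "F \<in> ?T ` forms i" using assms by auto
    qed
    with sub have "?T ` forms i = forms (2 * t - i)" by blast
    then show ?thesis using rank unfolding hilbert_fun_def by simp
  qed
qed

lemma compressed_gorenstein_perp: "compressed_gorenstein (perp (quad A ^ t)) (2 * t)"
  unfolding compressed_gorenstein_def using gorenstein_quotient_perp hilbert_fun_perp by blast

end

section \<open>Base change to the algebraic closure\<close>

lemma lookup_base_change: "Poly_Mapping.lookup (base_change F) m = to_ac (Poly_Mapping.lookup F m)"
  by (simp add: base_change_def Poly_Mapping.map.rep_eq when_def)

lemma base_change_single: "base_change (Poly_Mapping.single m c) = Poly_Mapping.single m (to_ac c)"
  by (rule poly_mapping_eqI) (simp add: lookup_base_change lookup_single when_def)

lemma base_change_add: "base_change (F + G) = base_change F + base_change G"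
  by (rule poly_mapping_eqI) (simp add: lookup_base_change lookup_add)

lemma base_change_cst: "base_change (cst c) = cst (to_ac c)"
  by (simp add: cst_def base_change_single)

lemma base_change_0 [simp]: "base_change 0 = 0"
  using base_change_cst[of 0] by simp

lemma base_change_1 [simp]: "base_change 1 = 1"
  using base_change_cst[of 1] by simp

lemma base_change_var: "base_change (var i) = var i"
  by (simp add: var_def base_change_single)

lemma base_change_var_mult: "base_change (var i * F) = var i * base_change F"
  by (induction F rule: poly4_single_induct)
    (simp_all only: base_change_single base_change_add distrib_left single_var_mult[symmetric])

lemma base_change_cst_mult: "base_change (cst c * F) = cst (to_ac c) * base_change F"
  by (induction F rule: poly4_single_induct)
    (simp_all add: base_change_add distrib_left base_change_single cst_def mult_single)

lemma base_change_mult: "base_change (F * G) = base_change F * base_change G"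
  by (induction F rule: poly4_induct)
    (simp_all add: base_change_cst_mult base_change_cst base_change_var_mult base_change_add distrib_right mult.assoc)

lemma base_change_sum: "base_change (sum f S) = (\<Sum>x\<in>S. base_change (f x))"
  by (induction S rule: infinite_finite_induct) (simp_all add: base_change_add)

lemma base_change_quad: "base_change (quad A) = quad (\<lambda>i j. to_ac (A i j))"
  by (simp add: quad_def base_change_sum base_change_cst_mult base_change_var_mult base_change_var)

lemma base_change_partial: "base_change (partial i F) = partial i (base_change F)"
  by (induction F rule: poly4_induct)
    (auto simp: base_change_cst base_change_var_mult base_change_add partial_var_mult partial_add)

lemma base_change_diff_by: "base_change (diff_by F G) = diff_by (base_change F) (base_change G)"
  by (induction G rule: poly4_induct)
    (simp_all add: base_change_cst base_change_cst_mult base_change_var_mult base_change_add diff_by_add_right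
      diff_by_var_mult base_change_partial)

lemma base_change_forms: "F \<in> forms d \<Longrightarrow> base_change F \<in> forms d"
  by (simp add: forms_def in_keys_iff lookup_base_change)

lemma base_change_harm: "h \<in> harm A d \<Longrightarrow> base_change h \<in> harm (\<lambda>i j. to_ac (A i j)) d"
  by (auto simp: harm_def base_change_forms simp flip: base_change_quad base_change_diff_by)

lemma (in dual_quadrics) dual_quadrics_base_change: "dual_quadrics (\<lambda>i j. to_ac (A i j)) (\<lambda>i j. to_ac (B i j))"
proof
  show "to_ac (A i j) = to_ac (A j i)" "to_ac (B i j) = to_ac (B j i)" for i j
    using A_sym B_sym by metis+
  have "(\<Sum>j\<in>UNIV. to_ac (A i j) * to_ac (B j k)) = to_ac (\<Sum>j\<in>UNIV. A i j * B j k)" for i k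
    by (simp add: to_ac_sum)
  then show "(\<Sum>j\<in>UNIV. to_ac (A i j) * to_ac (B j k)) = (if i = k then 1 else 0)" for i k
    by (simp add: A_B)
qed

text \<open>For the harder inclusion, monomials are decomposed over the small field. Extending
  scalars writes a harmonic \<open>h\<close> as \<open>g\<close> plus a multiple of the dual
  quadric, with \<open>g\<close> harmonic and in the extended ideal; then \<open>h - g\<close> is a
  harmonic multiple of the dual quadric, hence zero.\<close>

lemma (in dual_quadrics) ideal_gen_base_change_harm:
  "ideal_gen (base_change ` ideal_gen (harm A d)) = ideal_gen (harm (\<lambda>i j. to_ac (A i j)) d)"
proof
  let ?A = "\<lambda>i j. to_ac (A i j)" and ?B = "\<lambda>i j. to_ac (B i j)"
  interpret ac: dual_quadrics ?A ?B by (rule dual_quadrics_base_change)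
  have "is_ideal {x. base_change x \<in> ideal_gen (harm ?A d)}"
    by (auto simp: is_ideal_iff base_change_add base_change_mult ideal_gen_add ideal_gen_mult)
  then have "ideal_gen (harm A d) \<subseteq> {x. base_change x \<in> ideal_gen (harm ?A d)}"
    by (rule ideal_gen_minimal[rotated]) (use base_change_harm ideal_gen_superset in blast)
  then show "ideal_gen (base_change ` ideal_gen (harm A d)) \<subseteq> ideal_gen (harm ?A d)"
    by (intro ideal_gen_subsetI) blast
  let ?I = "ideal_gen (base_change ` ideal_gen (harm A d))"
  define P where "P F \<longleftrightarrow> (\<exists>g u. g \<in> ?I \<and> g \<in> harm ?A d \<and> F = g + quad ?B * u)" for F
  have P_add: "P (F + G)" if PF: "P F" and PG: "P G" for F G
  proof -
    obtain f u where "f \<in> ?I" "f \<in> harm ?A d" "F = f + quad ?B * u"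
      using PF unfolding P_def by blast
    moreover obtain g v where "g \<in> ?I" "g \<in> harm ?A d" "G = g + quad ?B * v"
      using PG unfolding P_def by blast
    ultimately show ?thesis unfolding P_def
      by (intro exI[of _ "f + g"] exI[of _ "u + v"])
        (auto simp: algebra_simps ideal_gen_add harm_def forms_add diff_by_add_left)
  qed
  have P_single: "P (Poly_Mapping.single m c)" if m: "expo_degree m = d" for m c
  proof -
    have "Poly_Mapping.single m 1 \<in> (forms d :: 'k poly4 set)" using forms_single m by blast
    then obtain h u where h: "h \<in> harm A d" "Poly_Mapping.single m 1 = h + quad B * u"
      by (rule harm_decompose)
    have "Poly_Mapping.single m c = cst c * base_change (Poly_Mapping.single m 1)"
      by (simp add: base_change_single cst_def mult_single)
    also have "\<dots> = cst c * base_change h + quad ?B * (cst c * base_change u)"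
      unfolding h(2) by (simp add: base_change_add base_change_mult base_change_quad algebra_simps)
    finally have "Poly_Mapping.single m c = cst c * base_change h + quad ?B * (cst c * base_change u)" .
    moreover have "cst c * base_change h \<in> ?I"
      by (rule ideal_gen_mult[OF subsetD[OF ideal_gen_superset imageI[OF subsetD[OF ideal_gen_superset h(1)]]]])
    moreover have "cst c * base_change h \<in> harm ?A d"
      using base_change_harm[OF h(1)] by (simp add: harm_def forms_cst_mult diff_by_cst_mult_left)
    ultimately show ?thesis unfolding P_def by blast
  qed
  have P_0: "P 0" unfolding P_def by (intro exI[of _ 0]) (auto simp: harm_def)
  show "ideal_gen (harm ?A d) \<subseteq> ?I"
  proof (rule ideal_gen_subsetI, rule subsetI)
    fix h assume h: "h \<in> harm ?A d"
    have "P (\<Sum>m\<in>S. Poly_Mapping.single m (Poly_Mapping.lookup h m))"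
      if "finite S" "S \<subseteq> Poly_Mapping.keys h" for S
      using that harm_forms[OF h] P_0 by induction (auto intro!: P_add P_single simp: forms_def)
    from this[of "Poly_Mapping.keys h"] have "P h"
      by (simp add: poly_mapping_sum_single)
    then obtain g u where g: "g \<in> ?I" "g \<in> harm ?A d" "h = g + quad ?B * u" unfolding P_def by blast
    have "h - g \<in> harm ?A d"
      using h g(2) by (simp add: harm_def forms_diff diff_by_diff_left)
    then have "h - g = 0" by (rule ac.harm_quad_dvd) (simp add: g(3))
    then show "h \<in> ?I" using g(1) by simp
  qed
qed

text \<open>On the line where coordinates 3 and 4 vanish the form is binary, so either
  \<open>(1, 0)\<close> is a zero or a root \<open>x\<close> of a quadratic polynomial gives the
  zero \<open>(x, 1)\<close>.\<close>

lemma proj_zeros_quad_nonempty: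
  fixes A :: "4 \<Rightarrow> 4 \<Rightarrow> 'k::alg_closed_field"
  shows "proj_zeros (quad A) \<noteq> {}"
proof (cases "A 1 1 = 0")
  case True
  define v :: "4 \<Rightarrow> 'k" where "v = (\<lambda>i. if i = 1 then 1 else 0)"
  have "v 1 \<noteq> 0" by (simp add: v_def)
  moreover have "eval4 v (quad A) = 0"
    using True by (simp add: eval4_quad sum_4 v_def)
  ultimately show ?thesis unfolding proj_zeros_def by force
next
  case False
  then have "degree [:A 2 2, A 1 2 + A 2 1, A 1 1:] > 0" by simp
  then obtain x where x: "poly [:A 2 2, A 1 2 + A 2 1, A 1 1:] x = 0"
    using alg_closed_imp_poly_has_root by blast
  define v :: "4 \<Rightarrow> 'k" where "v = (\<lambda>i. if i = 1 then x else if i = 2 then 1 else 0)"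
  have "v 2 \<noteq> 0" by (simp add: v_def)
  moreover have "eval4 v (quad A) = 0"
    using x by (simp add: eval4_quad sum_4 v_def algebra_simps)
  ultimately show ?thesis unfolding proj_zeros_def by force
qed

text \<open>Half the Hessian is a symmetric matrix representing \<open>Q\<close>, by Euler's
  identity. A nonzero kernel vector of it would be a point of the quadric at which all partial
  derivatives vanish, so smoothness makes the matrix invertible.\<close>

lemma smooth_quadric_dual:
  fixes Q :: "'k::field_char_0 poly4"
  assumes "smooth_quadric Q"
  obtains A B where "dual_quadrics A B" "Q = quad A"
proof -
  have Q: "Q \<in> forms 2" using assms by (simp add: smooth_quadric_def)
  define A where "A i j = dual_point (partial i Q) j / 2" for i j
  have "partial i Q \<in> forms 1" for i using forms_partial_diff[OF Q, of i] by simp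
  then have pQ: "partial i Q = lin (dual_point (partial i Q))" for i
    using lin_dual_point by metis
  have "cst (dual_point (partial i Q) j) = partial j (partial i Q)" for i j
    using arg_cong[OF pQ[of i], of "partial j"] by (simp add: partial_lin)
  then have "cst (dual_point (partial i Q) j) = cst (dual_point (partial j Q) i)" for i j
    by (metis partial_commute)
  then have A_sym: "A i j = A j i" for i j by (simp add: A_def)
  have "2 * Q = (\<Sum>i\<in>UNIV. var i * lin (dual_point (partial i Q)))"
    using euler_forms[OF Q] unfolding pQ[symmetric] by simp
  also have "\<dots> = 2 * quad A"
  proof -
    have "cst (dual_point (partial i Q) j) = 2 * cst (A i j)" for i j
      by (simp add: A_def flip: cst_numeral cst_mult)
    then have "var i * lin (dual_point (partial i Q)) = (\<Sum>j\<in>UNIV. 2 * (cst (A i j) * (var i * var j)))" for i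
      unfolding lin_def by (simp only: sum_distrib_left ac_simps)
    then show ?thesis by (simp only: quad_def sum_distrib_left)
  qed
  finally have Q_eq: "Q = quad A" by simp
  define M :: "'k^4^4" where "M = (\<chi> i j. A i j)"
  have "a = 0" if "M *v a = 0" for a
  proof (rule ccontr)
    assume "a \<noteq> 0"
    let ?v = "\<lambda>i. to_ac (a $ i)"
    have "(\<Sum>j\<in>UNIV. A i j * a $ j) = 0" for i
      using arg_cong[OF that, of "\<lambda>x. x $ i"] by (simp add: M_def matrix_vector_mult_def)
    then have Av: "(\<Sum>j\<in>UNIV. to_ac (A i j) * ?v j) = 0" for i
      by (metis (no_types, lifting) sum.cong to_ac_0 to_ac_mult to_ac_sum)
    have "eval4 ?v (base_change Q) = (\<Sum>i\<in>UNIV. ?v i * (\<Sum>j\<in>UNIV. to_ac (A i j) * ?v j))"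
      unfolding Q_eq base_change_quad eval4_quad by (simp add: sum_distrib_left ac_simps)
    then have "eval4 ?v (base_change Q) = 0" unfolding Av by simp
    moreover have "?v \<noteq> (\<lambda>_. 0)"
      using \<open>a \<noteq> 0\<close> by (auto simp: vec_eq_iff fun_eq_iff)
    ultimately have "?v \<in> proj_zeros (base_change Q)" by (simp add: proj_zeros_def)
    then obtain i where i: "eval4 ?v (partial i (base_change Q)) \<noteq> 0"
      using assms unfolding smooth_quadric_def by blast
    have "partial i (base_change Q) = 2 * (\<Sum>j\<in>UNIV. cst (to_ac (A i j)) * var j)"
      unfolding Q_eq base_change_quad by (rule partial_quad) (simp add: A_sym)
    then have "eval4 ?v (partial i (base_change Q)) = 2 * (\<Sum>j\<in>UNIV. to_ac (A i j) * ?v j)"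
      by (simp add: ev.ins_mult ev.ins_sum ev.ins_cst ev.ins_var ev.ins_cst[of _ 2, unfolded cst_numeral])
    then show False using i by (simp add: Av)
  qed
  then obtain N where N: "N ** M = mat 1"
    using matrix_left_invertible_ker[of M] by blast
  then have N': "M ** N = mat 1" by (simp add: matrix_left_right_inverse)
  have "transpose M = M" by (simp add: M_def transpose_def A_sym vec_eq_iff)
  \<comment> \<open>The transpose of the inverse is again a left inverse of the symmetric
    \<open>M\<close>, so it agrees with \<open>N\<close>.\<close>
  then have "transpose N ** M = mat 1"
    using matrix_transpose_mul[of M N] by (simp add: N' transpose_mat)
  then have "transpose N ** M ** N = N" by simp
  then have N_transpose: "transpose N = N"
    using N' by (simp flip: matrix_mul_assoc)
  have "transpose N $ i $ j = N $ j $ i" for i j by (simp add: transpose_def)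
  then have N_sym: "N $ i $ j = N $ j $ i" for i j unfolding N_transpose .
  have "dual_quadrics A (\<lambda>i j. N $ i $ j)"
  proof
    show "(\<Sum>j\<in>UNIV. A i j * N $ j $ k) = (if i = k then 1 else 0)" for i k
      using arg_cong[OF N', of "\<lambda>x. x $ i $ k"] by (simp add: M_def matrix_matrix_mult_def mat_def)
  qed (rule A_sym N_sym)+
  then show ?thesis using that Q_eq by blast
qed

text \<open>If the quadric has no point over \<open>k\<close>, the ideal of powers over
  \<open>k\<close> is zero while the annihilator is not. The equality of ideals is therefore stated
  over \<open>k\<close> in the presence of a point, and over the algebraic closure in
  general.\<close>

theorem theorem3p4:
  fixes Q :: "'k::field_char_0 poly4" and t :: nat
  assumes "smooth_quadric Q" and "t > 0"
  shows "(proj_zeros Q \<noteq> {} \<longrightarrow> perp (Q ^ t) = dual_power_ideal Q (t + 1)) \<and>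
    ideal_gen (base_change ` perp (Q ^ t)) = dual_power_ideal (base_change Q) (t + 1) \<and>
    compressed_gorenstein (perp (Q ^ t)) (2 * t)"
proof -
  obtain A B where "dual_quadrics A B" and Q: "Q = quad A"
    using smooth_quadric_dual[OF assms(1)] .
  then interpret dual_quadrics A B by simp
  interpret ac: dual_quadrics "\<lambda>i j. to_ac (A i j)" "\<lambda>i j. to_ac (B i j)"
    by (rule dual_quadrics_base_change)
  show ?thesis
    using dual_power_ideal_eq ac.dual_power_ideal_eq[OF proj_zeros_quad_nonempty]
      ideal_gen_base_change_harm compressed_gorenstein_perp
    unfolding Q by (simp add: perp_power base_change_quad)
qed

end
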